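(* Let $\Sigma\subset\mathbb{Z}^N$ be simply connected and let $(x,n):\Sigma\to\mathbb{R}^3\times S^2$ be a principal net with principal curvatures $\kappa_{ij}\in\mathbb{R}^\times$ and regular Legendre lift. Then $(x,n)$ lifts to an $\Omega$-net if and only if there exist nets $\check{x},\check{n}:\Sigma\to\mathbb{R}^3$, edge-parallel to $x$, satisfying $$\mathrm{d}\check{x}\curlywedge\mathrm{d}x+\mathrm{d}\check{n}\curlywedge\mathrm{d}n=0,$$ or, equivalently, $A(\check{x},x)+A(\check{n},n)=0$, together with $$\mathrm{d}\check{x}_{ji}\neq\kappa_{ij}\,\mathrm{d}\check{n}_{ji}\quad\text{on each edge } ij.$$ In this case, $(\check{x},n)$ is also a principal net whose Legendre lift is an $\Omega$-net when it is regular.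
   Context: Domain: an edge $ij$ of $\Sigma\subset\mathbb{Z}^N$ is a pair of points of $\Sigma$ differing by a standard unit vector; a quadrilateral is an elementary square with all four vertices $i,j,k,\ell$ (in cyclic order) in $\Sigma$. $\Sigma$ is simply connected if any two points are joined by an edge-path in $\Sigma$ and any two edge-paths in $\Sigma$ with the same end-points are related by finitely many moves: (a) replace $i$ by $(iji)$ or conversely, $ij$ an edge; (b) replace $(k\ell i)$ by $(kji)$ on a quadrilateral. A vector-valued $1$-form $\alpha$ assigns $\alpha_{ji}=-\alpha_{ij}$ to each oriented edge from $i$ to $j$; it is closed if $\alpha_{i\ell}+\alpha_{\ell k}+\alpha_{kj}+\alpha_{ji}=0$ on every quadrilateral. $\mathrm{d}x_{ji}=x_j-x_i$. For vector-valued $1$-forms, $$(\alpha\curlywedge\beta)_{\ell kji}=\tfrac14\bigl((\alpha_{ji}+\alpha_{k\ell})\wedge(\beta_{\ell i}+\beta_{kj})-(\alpha_{\ell i}+\alpha_{kj})\wedge(\beta_{ji}+\beta_{k\ell})\bigr).$$ For edge-parallel $u,v$, the mixed area is $A(u,v)=\tfrac12\mathrm{d}u\curlywedge\mathrm{d}v$ (the polarisation of $A(u,u)_{\ell kji}=\tfrac12(u_i-u_k)\wedge(u_j-u_\ell)$). Nets $u,v$ are edge-parallel if $\mathrm{d}u_{ij}\parallel\mathrm{d}v_{ij}$ on each edge; here $\mathrm{d}\check x_{ij},\mathrm{d}\check n_{ij}$ are (possibly zero) multiples of $\mathrm{d}x_{ij}$. $(x,n):\Sigma\to\mathbb{R}^3\times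 S^2$ is a principal net if on each edge there is a principal curvature $\kappa_{ij}$ with $\kappa_{ij}x_i+n_i=\kappa_{ij}x_j+n_j$, $\kappa_{ij}\in\mathbb{R}^\times$. Lie sphere geometry: in $\mathbb{R}^{4,2}$ (form $(\cdot,\cdot)$ of signature $(4,2)$) fix $\mathfrak{p}$ with $(\mathfrak{p},\mathfrak{p})=-1$ and null $\mathfrak{o},\mathfrak{q}\perp\mathfrak{p}$ with $(\mathfrak{o},\mathfrak{q})=-1$, so that $\mathbb{R}^{4,2}=\langle\mathfrak{o},\mathfrak{q}\rangle\oplus\mathbb{R}^3\oplus\langle\mathfrak{p}\rangle$ orthogonally with $\mathbb{R}^3$ Euclidean. The Legendre lift of $(x,n)$ is the map $f=\langle y,\mathfrak{t}\rangle$ into the totally null $2$-planes, where $y=\mathfrak{o}+x+\tfrac12(x,x)\mathfrak{q}$ and $\mathfrak{t}=n+\mathfrak{p}+(x,n)\mathfrak{q}$; it satisfies $f_i\cap f_j\ne\{0\}$ on each edge. It is regular if (i) on each edge $f_{ij}:=f_i+f_j$ is $3$-dimensional, so $s_{ij}:=f_i\cap f_j$ is $1$-dimensional (spanned by $\kappa_{ij}y_i+\mathfrak{t}_i=\kappa_{ij}y_j+\mathfrak{t}_j$), and (ii) on each quadrilateral $s_{ij}\wedge s_{jk}\wedge s_{k\ell}\wedge s_{\ell i}\neq\{0\}$. A regular such $f$ is an $\Omega$-net if it is applicable (equivalently, spanned by Koenigs dual sections): there is a closed $\Lambda^2\mathbb{R}^{4,2}$-valued $1$-form $\eta$ with $\eta_{ij}\in\Lambda^2f_{ij}$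 and $\eta_{ij}\wedge s_{ij}\ne\{0\}$ on each edge. $(x,n)$ lifts to an $\Omega$-net if its Legendre lift is an $\Omega$-net.
   Formalization: The "if" direction and the final Ω-net claim assume that no quadrilateral of x has its four points on a line; (x̌,n) is principal with curvature ∞ allowed where dx̌ = 0, and in the stated sense if dx̌ vanishes on no edge. Without this the claims fail. *)

theory Defs
  imports "HOL-Analysis.Analysis"
begin

section \<open>Domains in the integer lattice\<close>

type_synonym 'N lattice = "int ^ 'N"

definition edge :: "('N::finite) lattice set \<Rightarrow> 'N lattice \<Rightarrow> 'N lattice \<Rightarrow> bool" where
  "edge \<Sigma> i j \<longleftrightarrow> i \<in> \<Sigma> \<and> j \<in> \<Sigma> \<and> (\<exists>a. j = i + axis a 1 \<or> i = j + axis a 1)"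

text \<open>The signs and the choice of the two directions produce all eight cyclic labellings of an
  elementary square.\<close>

definition quad ::
    "('N::finite) lattice set \<Rightarrow> 'N lattice \<Rightarrow> 'N lattice \<Rightarrow> 'N lattice \<Rightarrow> 'N lattice \<Rightarrow> bool" where
  "quad \<Sigma> i j k l \<longleftrightarrow> {i, j, k, l} \<subseteq> \<Sigma> \<and>
     (\<exists>a b. \<exists>\<sigma>\<in>{1, -1}. \<exists>\<tau>\<in>{1, -1}. a \<noteq> b \<and>
        j = i + axis a \<sigma> \<and> k = i + axis a \<sigma> + axis b \<tau> \<and> l = i + axis b \<tau>)"

definition edge_path :: "('N::finite) lattice set \<Rightarrow> 'N lattice list \<Rightarrow> bool" where
  "edge_path \<Sigma> p \<longleftrightarrow> p \<noteq> [] \<and> set p \<subseteq> \<Sigma> \<and> successively (edge \<Sigma>) p"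

inductive path_move :: "('N::finite) lattice set \<Rightarrow> 'N lattice list \<Rightarrow> 'N lattice list \<Rightarrow> bool"
  for \<Sigma> where
  spike: "edge \<Sigma> i j \<Longrightarrow> path_move \<Sigma> (us @ [i] @ vs) (us @ [i, j, i] @ vs)"
| flip: "quad \<Sigma> i j k l \<Longrightarrow> path_move \<Sigma> (us @ [k, l, i] @ vs) (us @ [k, j, i] @ vs)"

definition lattice_simply_connected :: "('N::finite) lattice set \<Rightarrow> bool" where
  "lattice_simply_connected \<Sigma> \<longleftrightarrow>
     (\<forall>i\<in>\<Sigma>. \<forall>j\<in>\<Sigma>. \<exists>p. edge_path \<Sigma> p \<and> hd p = i \<and> last p = j) \<and>
     (\<forall>p q. edge_path \<Sigma> p \<and> edge_path \<Sigma> q \<and> hd p = hd q \<and> last p = last q \<longrightarrow>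
        equivclp (path_move \<Sigma>) p q)"


section \<open>Exterior products\<close>

text \<open>Multivectors of degree 2, 3 and 4 over \<^typ>\<open>real ^ 'm\<close> are represented by their (alternating)
  component arrays. The last three products multiply a multivector by a vector from the right,
  with \<open>(v\<^sub>1 \<wedge> \<dots> \<wedge> v\<^sub>p)\<close> having components \<open>det (v\<^sub>r $ a\<^sub>s)\<close>.\<close>

definition wedge :: "real ^ 'm \<Rightarrow> real ^ 'm \<Rightarrow> real ^ 'm ^ ('m::finite)" where
  "wedge u v = (\<chi> a b. u $ a * v $ b - u $ b * v $ a)"

definition wedge3 :: "real ^ 'm ^ 'm \<Rightarrow> real ^ 'm \<Rightarrow> real ^ 'm ^ 'm ^ ('m::finite)" where
  "wedge3 \<omega> v = (\<chi> a b c. \<omega> $ a $ b * v $ c + \<omega> $ b $ c * v $ a + \<omega> $ c $ a * v $ b)"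

definition wedge4 ::
    "real ^ 'm ^ 'm ^ 'm \<Rightarrow> real ^ 'm \<Rightarrow> real ^ 'm ^ 'm ^ 'm ^ ('m::finite)" where
  "wedge4 \<tau> v = (\<chi> a b c d. \<tau> $ a $ b $ c * v $ d - \<tau> $ b $ c $ d * v $ a
                           + \<tau> $ c $ d $ a * v $ b - \<tau> $ d $ a $ b * v $ c)"

definition Lambda2 :: "(real ^ ('m::finite)) set \<Rightarrow> (real ^ 'm ^ 'm) set" where
  "Lambda2 W = span {wedge u v | u v. u \<in> W \<and> v \<in> W}"


section \<open>Discrete 1-forms\<close>

text \<open>A 1-form is applied as \<open>\<alpha> j i\<close> for the value \<open>\<alpha>\<^bsub>ji\<^esub>\<close> on the edge oriented from \<open>i\<close> to \<open>j\<close>, and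
  a function of quadrilaterals as \<open>F l k j i\<close>. Values off the edges are irrelevant.\<close>

definition one_form ::
    "('N::finite) lattice set \<Rightarrow> ('N lattice \<Rightarrow> 'N lattice \<Rightarrow> 'b::real_vector) \<Rightarrow> bool" where
  "one_form \<Sigma> \<alpha> \<longleftrightarrow> (\<forall>i j. edge \<Sigma> i j \<longrightarrow> \<alpha> j i = - \<alpha> i j)"

definition closed_form ::
    "('N::finite) lattice set \<Rightarrow> ('N lattice \<Rightarrow> 'N lattice \<Rightarrow> 'b::real_vector) \<Rightarrow> bool" where
  "closed_form \<Sigma> \<alpha> \<longleftrightarrow> (\<forall>i j k l. quad \<Sigma> i j k l \<longrightarrow> \<alpha> i l + \<alpha> l k + \<alpha> k j + \<alpha> j i = 0)"

definition dd :: "('v \<Rightarrow> 'b::real_vector) \<Rightarrow> 'v \<Rightarrow> 'v \<Rightarrow> 'b" where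
  "dd x j i = x j - x i"

definition curly_wedge ::
    "('v \<Rightarrow> 'v \<Rightarrow> real ^ 'm) \<Rightarrow> ('v \<Rightarrow> 'v \<Rightarrow> real ^ 'm) \<Rightarrow>
     'v \<Rightarrow> 'v \<Rightarrow> 'v \<Rightarrow> 'v \<Rightarrow> real ^ 'm ^ ('m::finite)"  (infixl \<open>\<curlywedge>\<close> 75) where
  "(\<alpha> \<curlywedge> \<beta>) l k j i = (1/4) *\<^sub>R
     (wedge (\<alpha> j i + \<alpha> k l) (\<beta> l i + \<beta> k j) - wedge (\<alpha> l i + \<alpha> k j) (\<beta> j i + \<beta> k l))"

definition mixed_area ::
    "('v \<Rightarrow> real ^ 'm) \<Rightarrow> ('v \<Rightarrow> real ^ 'm) \<Rightarrow>
     'v \<Rightarrow> 'v \<Rightarrow> 'v \<Rightarrow> 'v \<Rightarrow> real ^ 'm ^ ('m::finite)" where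
  "mixed_area u v l k j i = (1/2) *\<^sub>R (dd u \<curlywedge> dd v) l k j i"

text \<open>\<open>edge_parallel \<Sigma> u x\<close> requires the differences of \<open>u\<close> to be multiples, possibly zero, of those
  of \<open>x\<close>.\<close>

definition edge_parallel ::
    "('N::finite) lattice set \<Rightarrow> ('N lattice \<Rightarrow> 'b::real_vector) \<Rightarrow> ('N lattice \<Rightarrow> 'b) \<Rightarrow> bool" where
  "edge_parallel \<Sigma> u x \<longleftrightarrow> (\<forall>i j. edge \<Sigma> i j \<longrightarrow> (\<exists>c. dd u j i = c *\<^sub>R dd x j i))"


section \<open>Principal nets\<close>

definition principal_curvatures ::
    "('N::finite) lattice set \<Rightarrow> ('N lattice \<Rightarrow> real ^ 3) \<Rightarrow> ('N lattice \<Rightarrow> real ^ 3) \<Rightarrow>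
     ('N lattice \<Rightarrow> 'N lattice \<Rightarrow> real) \<Rightarrow> bool" where
  "principal_curvatures \<Sigma> x n \<kappa> \<longleftrightarrow> (\<forall>i j. edge \<Sigma> i j \<longrightarrow>
     \<kappa> i j = \<kappa> j i \<and> \<kappa> i j \<noteq> 0 \<and> \<kappa> i j *\<^sub>R x i + n i = \<kappa> i j *\<^sub>R x j + n j)"

definition principal_net ::
    "('N::finite) lattice set \<Rightarrow> ('N lattice \<Rightarrow> real ^ 3) \<Rightarrow> ('N lattice \<Rightarrow> real ^ 3) \<Rightarrow> bool" where
  "principal_net \<Sigma> x n \<longleftrightarrow> (\<forall>i\<in>\<Sigma>. n i \<in> sphere 0 1) \<and> (\<exists>\<kappa>. principal_curvatures \<Sigma> x n \<kappa>)"

text \<open>The same with the principal curvature \<open>\<infinity>\<close> admitted: after division by \<open>\<kappa>\<close> the defining equation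
  then reads \<open>x i = x j\<close>.\<close>

definition principal_net_inf ::
    "('N::finite) lattice set \<Rightarrow> ('N lattice \<Rightarrow> real ^ 3) \<Rightarrow> ('N lattice \<Rightarrow> real ^ 3) \<Rightarrow> bool" where
  "principal_net_inf \<Sigma> x n \<longleftrightarrow> (\<forall>i\<in>\<Sigma>. n i \<in> sphere 0 1) \<and>
     (\<forall>i j. edge \<Sigma> i j \<longrightarrow> x i = x j \<or> (\<exists>\<kappa>. \<kappa> \<noteq> 0 \<and> \<kappa> *\<^sub>R x i + n i = \<kappa> *\<^sub>R x j + n j))"

text \<open>For a regular Legendre lift \<open>f\<close>, the points of a quadrilateral are collinear iff the space
  spanned by the four planes \<open>f\<^sub>i\<close> contains the point sphere at infinity. On such a quadrilateral every
  mixed area of nets edge-parallel to \<open>x\<close> vanishes, so that the area condition is void and does not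
  yield a closed form. Such quadrilaterals occur in regular principal nets, with \<open>n\<close> alternating
  between two values, and have to be excluded where a closed form is constructed.\<close>

definition noncollinear_quads ::
    "('N::finite) lattice set \<Rightarrow> ('N lattice \<Rightarrow> real ^ 3) \<Rightarrow> bool" where
  "noncollinear_quads \<Sigma> x \<longleftrightarrow>
     (\<forall>i j k l. quad \<Sigma> i j k l \<longrightarrow> \<not> collinear {x i, x j, x k, x l})"

definition associated_nets ::
    "('N::finite) lattice set \<Rightarrow> ('N lattice \<Rightarrow> real ^ 3) \<Rightarrow> ('N lattice \<Rightarrow> real ^ 3) \<Rightarrow>
     ('N lattice \<Rightarrow> 'N lattice \<Rightarrow> real) \<Rightarrow> ('N lattice \<Rightarrow> real ^ 3) \<Rightarrow> ('N lattice \<Rightarrow> real ^ 3) \<Rightarrow> bool"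
  where
  "associated_nets \<Sigma> x n \<kappa> xc nc \<longleftrightarrow>
     edge_parallel \<Sigma> xc x \<and> edge_parallel \<Sigma> nc x \<and>
     (\<forall>i j k l. quad \<Sigma> i j k l \<longrightarrow> (dd xc \<curlywedge> dd x) l k j i + (dd nc \<curlywedge> dd n) l k j i = 0) \<and>
     (\<forall>i j. edge \<Sigma> i j \<longrightarrow> dd xc j i \<noteq> \<kappa> i j *\<^sub>R dd nc j i)"


section \<open>Lie sphere geometry\<close>

type_synonym R42 = "real ^ (4 + 2)"

definition lie_form :: "R42 \<Rightarrow> R42 \<Rightarrow> real" where
  "lie_form u v = (\<Sum>a\<in>UNIV. u $ Inl a * v $ Inl a) - (\<Sum>b\<in>UNIV. u $ Inr b * v $ Inr b)"

text \<open>The identification of \<^typ>\<open>real ^ 3\<close> with the orthogonal complement of \<open>o\<close>, \<open>q\<close>, \<open>p\<close> is the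
  linear isometry \<open>\<iota>\<close>; by dimension, these span \<^typ>\<open>R42\<close>.\<close>

definition lie_frame :: "R42 \<Rightarrow> R42 \<Rightarrow> R42 \<Rightarrow> (real ^ 3 \<Rightarrow> R42) \<Rightarrow> bool" where
  "lie_frame \<oo> \<qq> \<pp> \<iota> \<longleftrightarrow>
     lie_form \<pp> \<pp> = -1 \<and>
     lie_form \<oo> \<oo> = 0 \<and> lie_form \<qq> \<qq> = 0 \<and> lie_form \<oo> \<qq> = -1 \<and>
     lie_form \<oo> \<pp> = 0 \<and> lie_form \<qq> \<pp> = 0 \<and>
     linear \<iota> \<and> (\<forall>u v. lie_form (\<iota> u) (\<iota> v) = u \<bullet> v) \<and>
     (\<forall>u. lie_form (\<iota> u) \<oo> = 0 \<and> lie_form (\<iota> u) \<qq> = 0 \<and> lie_form (\<iota> u) \<pp> = 0)"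

definition legendre_lift ::
    "R42 \<Rightarrow> R42 \<Rightarrow> R42 \<Rightarrow> (real ^ 3 \<Rightarrow> R42) \<Rightarrow>
     ('v \<Rightarrow> real ^ 3) \<Rightarrow> ('v \<Rightarrow> real ^ 3) \<Rightarrow> 'v \<Rightarrow> R42 set" where
  "legendre_lift \<oo> \<qq> \<pp> \<iota> x n i =
     span {\<oo> + \<iota> (x i) + ((x i \<bullet> x i) / 2) *\<^sub>R \<qq>, \<iota> (n i) + \<pp> + (x i \<bullet> n i) *\<^sub>R \<qq>}"

definition legendre_map :: "('N::finite) lattice set \<Rightarrow> ('N lattice \<Rightarrow> R42 set) \<Rightarrow> bool" where
  "legendre_map \<Sigma> f \<longleftrightarrow>
     (\<forall>i\<in>\<Sigma>. subspace (f i) \<and> dim (f i) = 2 \<and> (\<forall>u\<in>f i. \<forall>v\<in>f i. lie_form u v = 0)) \<and>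
     (\<forall>i j. edge \<Sigma> i j \<longrightarrow> f i \<inter> f j \<noteq> {0})"

definition edge_sum :: "('v \<Rightarrow> R42 set) \<Rightarrow> 'v \<Rightarrow> 'v \<Rightarrow> R42 set" where
  "edge_sum f i j = {u + v | u v. u \<in> f i \<and> v \<in> f j}"

definition edge_meet :: "('v \<Rightarrow> R42 set) \<Rightarrow> 'v \<Rightarrow> 'v \<Rightarrow> R42 set" where
  "edge_meet f i j = f i \<inter> f j"

text \<open>A product of lines is different from \<open>{0}\<close> iff some product of their elements is nonzero.\<close>

definition regular_map :: "('N::finite) lattice set \<Rightarrow> ('N lattice \<Rightarrow> R42 set) \<Rightarrow> bool" where
  "regular_map \<Sigma> f \<longleftrightarrow>
     (\<forall>i j. edge \<Sigma> i j \<longrightarrow> dim (edge_sum f i j) = 3) \<and>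
     (\<forall>i j k l. quad \<Sigma> i j k l \<longrightarrow>
        (\<exists>a \<in> edge_meet f i j. \<exists>b \<in> edge_meet f j k. \<exists>c \<in> edge_meet f k l. \<exists>d \<in> edge_meet f l i.
           wedge4 (wedge3 (wedge a b) c) d \<noteq> 0))"

definition applicable :: "('N::finite) lattice set \<Rightarrow> ('N lattice \<Rightarrow> R42 set) \<Rightarrow> bool" where
  "applicable \<Sigma> f \<longleftrightarrow>
     (\<exists>\<eta> :: 'N lattice \<Rightarrow> 'N lattice \<Rightarrow> real ^ (4 + 2) ^ (4 + 2).
        one_form \<Sigma> \<eta> \<and> closed_form \<Sigma> \<eta> \<and>
        (\<forall>i j. edge \<Sigma> i j \<longrightarrow>
           \<eta> i j \<in> Lambda2 (edge_sum f i j) \<and> (\<exists>s \<in> edge_meet f i j. wedge3 (\<eta> i j) s \<noteq> 0)))"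

definition omega_net :: "('N::finite) lattice set \<Rightarrow> ('N lattice \<Rightarrow> R42 set) \<Rightarrow> bool" where
  "omega_net \<Sigma> f \<longleftrightarrow> legendre_map \<Sigma> f \<and> regular_map \<Sigma> f \<and> applicable \<Sigma> f"

end

theory Submission
  imports Defs
begin

text \<open>
  On an edge the contact elements \<open>f\<^sub>i = \<langle>y\<^sub>i, t\<^sub>i\<rangle>\<close> and \<open>f\<^sub>j\<close> of the Legendre lift share a sphere, so that
  \<open>dy = \<rho> dt\<close> with the same factor \<open>\<rho> = -1/\<kappa>\<close> as in \<open>dx = \<rho> dn\<close> (lemma \<open>point_lift_diff\<close>), and \<open>f\<^sub>i + f\<^sub>j\<close> is
  spanned by \<open>y\<^sub>i\<close>, \<open>t\<^sub>i\<close> and \<open>dt\<close>. The correspondence of the theorem is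
  \<open>\<eta> = (A y\<^sub>i + B t\<^sub>i) \<and> dt\<close> with \<open>dxc = A dn\<close> and \<open>dnc = B dn\<close>,
  where \<open>\<eta> \<and> s \<noteq> 0\<close> becomes \<open>\<rho> A + B \<noteq> 0\<close>, that is, \<open>dxc \<noteq> \<kappa> dnc\<close>.

  A closed \<open>\<eta>\<close> may also have a component along \<open>y\<^sub>i \<and> t\<^sub>i\<close>. This is the \<open>o \<and> p\<close> part of \<open>\<eta>\<close>,
  a closed real form; it is exact and is removed by subtracting \<open>d(r y \<and> t)\<close>. The \<open>o\<close> and \<open>p\<close> parts of the new form are then the closed
  forms \<open>dxc\<close> and \<open>dnc\<close>, and its part in \<open>\<Lambda>\<^sup>2\<real>\<^sup>3\<close> is \<open>x \<and> dxc + n \<and> dnc\<close>, whose derivative is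
  \<open>dxc \<curlywedge> dx + dnc \<curlywedge> dn\<close> by the Leibniz rule (lemma \<open>omega_dual_of_applicable\<close>).

  Conversely, the same computation shows that for associated nets the derivative of \<open>\<eta>\<close> on a
  quadrilateral has no components except those of the form \<open>q \<and> w\<close>. It lies in \<open>\<Lambda>\<^sup>2V\<close> for the span \<open>V\<close> of the
  four contact elements. By regularity \<open>V\<close> has dimension at most 4, and unless the quadrilateral is
  collinear this leaves no room for \<open>q\<close>. Since \<open>q \<notin> V\<close>, the derivative vanishes (lemma \<open>applicable_lift\<close>).

  Expressed by \<open>\<rho>\<close>, \<open>A\<close>, \<open>B\<close>, the conditions are symmetric under exchange of \<open>x\<close> and \<open>xc\<close>. The statement about
  \<open>(xc, n)\<close> is therefore the converse direction applied with the two nets exchanged.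
\<close>

section \<open>Integration of closed 1-forms\<close>

lemma edge_sym: "edge \<Sigma> i j \<Longrightarrow> edge \<Sigma> j i"
  unfolding edge_def by blast

lemma axis_minus_one: "axis a (-1) = - (axis a 1 :: int ^ 'N)"
  by (simp add: vec_eq_iff axis_def)

lemma edge_shift:
  assumes "i \<in> \<Sigma>" "j \<in> \<Sigma>" "\<sigma> \<in> {1, -1 :: int}" "j = i + axis a \<sigma>"
  shows "edge \<Sigma> i j"
  using assms unfolding edge_def by (auto simp: axis_minus_one)

lemma quad_edges:
  assumes "quad \<Sigma> i j k l"
  shows "edge \<Sigma> i j" "edge \<Sigma> j k" "edge \<Sigma> k l" "edge \<Sigma> l i"
proof -
  obtain a b \<sigma> \<tau> where *: "{i, j, k, l} \<subseteq> \<Sigma>" "\<sigma> \<in> {1, -1 :: int}" "\<tau> \<in> {1, -1 :: int}"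
      "j = i + axis a \<sigma>" "k = i + axis a \<sigma> + axis b \<tau>" "l = i + axis b \<tau>"
    using assms unfolding quad_def by blast
  have "k = j + axis b \<tau>" "k = l + axis a \<sigma>"
    using * by (simp_all add: algebra_simps)
  then show "edge \<Sigma> i j" "edge \<Sigma> j k" "edge \<Sigma> k l" "edge \<Sigma> l i"
    using * edge_shift[of i \<Sigma> j \<sigma> a] edge_shift[of j \<Sigma> k \<tau> b]
      edge_shift[of l \<Sigma> k \<sigma> a] edge_shift[of i \<Sigma> l \<tau> b] edge_sym
    by (blast intro: edge_sym)+
qed

fun path_sum :: "('v \<Rightarrow> 'v \<Rightarrow> 'b::real_vector) \<Rightarrow> 'v list \<Rightarrow> 'b" where
  "path_sum \<alpha> (i # j # p) = \<alpha> j i + path_sum \<alpha> (j # p)"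
| "path_sum \<alpha> _ = 0"

lemma path_sum_append: "path_sum \<alpha> (us @ i # vs) = path_sum \<alpha> (us @ [i]) + path_sum \<alpha> (i # vs)"
proof (induction us)
  case (Cons u us)
  then show ?case by (cases us) (auto simp: add.assoc)
qed simp

lemma path_sum_move:
  assumes "one_form \<Sigma> \<alpha>" "closed_form \<Sigma> \<alpha>" "path_move \<Sigma> p q"
  shows "path_sum \<alpha> p = path_sum \<alpha> q"
  using assms(3)
proof cases
  case (spike i j us vs)
  have "\<alpha> i j + \<alpha> j i = 0"
    using assms(1) spike unfolding one_form_def by (metis add.right_inverse)
  then have "path_sum \<alpha> (i # j # i # vs) = path_sum \<alpha> (i # vs)"
    by (simp add: add.assoc[symmetric] add.commute)
  then show ?thesis
    using spike path_sum_append[of \<alpha> us i vs] path_sum_append[of \<alpha> us i "j # i # vs"] by simp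
next
  case (flip i j k l us vs)
  note e = quad_edges[OF flip(3)]
  have "\<alpha> i l + \<alpha> l k + \<alpha> k j + \<alpha> j i = 0"
    using assms(2) flip(3) unfolding closed_form_def by blast
  moreover have "\<alpha> k j = - \<alpha> j k" "\<alpha> j i = - \<alpha> i j"
    using assms(1) e unfolding one_form_def by blast+
  ultimately have "\<alpha> l k + \<alpha> i l = \<alpha> j k + \<alpha> i j"
    by (simp add: algebra_simps)
  then have "path_sum \<alpha> (k # l # i # vs) = path_sum \<alpha> (k # j # i # vs)"
    by (simp add: add.assoc[symmetric])
  then show ?thesis
    using flip path_sum_append[of \<alpha> us k "l # i # vs"] path_sum_append[of \<alpha> us k "j # i # vs"]
    by simp
qed

lemma path_sum_equiv:
  assumes "one_form \<Sigma> \<alpha>" "closed_form \<Sigma> \<alpha>" "equivclp (path_move \<Sigma>) p q"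
  shows "path_sum \<alpha> p = path_sum \<alpha> q"
  using assms(3)
proof (induction rule: equivclp_induct)
  case (step y z)
  then show ?case using path_sum_move[OF assms(1,2)] by metis
qed simp

text \<open>The potential at a point is the sum of the form along any path from a base point: inserting
  or deleting a spike leaves this sum alone because the form is odd, flipping a quadrilateral because it
  is closed.\<close>

lemma closed_form_exact:
  assumes sc: "lattice_simply_connected \<Sigma>" and "one_form \<Sigma> \<alpha>" "closed_form \<Sigma> \<alpha>"
  obtains g where "\<And>i j. edge \<Sigma> i j \<Longrightarrow> \<alpha> j i = dd g j i"
proof (cases "\<Sigma> = {}")
  case True
  then show ?thesis using that by (auto simp: edge_def)
next
  case False
  then obtain b where b: "b \<in> \<Sigma>" by blast
  define P where "P i p \<longleftrightarrow> edge_path \<Sigma> p \<and> hd p = b \<and> last p = i" for i p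
  define g where "g i = path_sum \<alpha> (SOME p. P i p)" for i
  have g: "g i = path_sum \<alpha> p" if "P i p" for i p
  proof -
    define p' where "p' = (SOME p. P i p)"
    have "P i p'" unfolding p'_def using that by (rule someI)
    then have "edge_path \<Sigma> p' \<and> edge_path \<Sigma> p \<and> hd p' = hd p \<and> last p' = last p"
      using that unfolding P_def by simp
    then have "equivclp (path_move \<Sigma>) p' p"
      using sc unfolding lattice_simply_connected_def by blast
    then show ?thesis unfolding g_def p'_def[symmetric] by (rule path_sum_equiv[OF assms(2,3)])
  qed
  have "\<alpha> j i = dd g j i" if e: "edge \<Sigma> i j" for i j
  proof -
    have "i \<in> \<Sigma>" "j \<in> \<Sigma>" using e by (auto simp: edge_def)
    then obtain p where p: "P i p"
      using sc b unfolding lattice_simply_connected_def P_def by blast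
    then have "p \<noteq> []" "last p = i" by (auto simp: P_def edge_path_def)
    then obtain us where us: "p = us @ [i]"
      using append_butlast_last_id[of p] by metis
    have "P j (p @ [j])"
      using p e \<open>j \<in> \<Sigma>\<close> \<open>p \<noteq> []\<close> unfolding P_def edge_path_def
      by (simp add: successively_append_iff)
    then have "g j = path_sum \<alpha> (us @ i # [j])" using g us by simp
    also have "\<dots> = g i + \<alpha> j i" using g[OF p] us path_sum_append[of \<alpha> us i "[j]"] by simp
    finally show ?thesis by (simp add: dd_def)
  qed
  then show ?thesis using that by blast
qed

lemma one_form_linear:
  assumes "linear L" "one_form \<Sigma> \<alpha>"
  shows "one_form \<Sigma> (\<lambda>j i. L (\<alpha> j i))"
  using assms unfolding one_form_def by (metis linear_neg)

lemma closed_form_linear: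
  assumes "linear L" "closed_form \<Sigma> \<alpha>"
  shows "closed_form \<Sigma> (\<lambda>j i. L (\<alpha> j i))"
  using assms unfolding closed_form_def by (metis linear_add linear_0)

lemma one_form_minus_dd: "one_form \<Sigma> \<alpha> \<Longrightarrow> one_form \<Sigma> (\<lambda>j i. \<alpha> j i - dd g j i)"
  unfolding one_form_def dd_def by auto

lemma closed_form_minus_dd: "closed_form \<Sigma> \<alpha> \<Longrightarrow> closed_form \<Sigma> (\<lambda>j i. \<alpha> j i - dd g j i)"
  unfolding closed_form_def dd_def by (simp add: algebra_simps)


section \<open>Exterior algebra\<close>

lemma wedge_self [simp]: "wedge u u = 0"
  by (simp add: wedge_def vec_eq_iff)

lemma wedge_antisym: "wedge v u = - wedge u v"
  by (simp add: wedge_def vec_eq_iff)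

lemma bilinear_wedge: "bilinear wedge"
  unfolding bilinear_def wedge_def
  by (auto intro!: linearI simp: vec_eq_iff algebra_simps)

lemmas wedge_simps =
  bilinear_ladd[OF bilinear_wedge] bilinear_radd[OF bilinear_wedge]
  bilinear_lmul[OF bilinear_wedge] bilinear_rmul[OF bilinear_wedge]
  bilinear_lneg[OF bilinear_wedge] bilinear_rneg[OF bilinear_wedge]
  bilinear_lsub[OF bilinear_wedge] bilinear_rsub[OF bilinear_wedge]
  bilinear_lzero[OF bilinear_wedge] bilinear_rzero[OF bilinear_wedge]

lemma wedge_mult_vector: "wedge a b *v w = (b \<bullet> w) *\<^sub>R a - (a \<bullet> w) *\<^sub>R b"
  by (simp add: vec_eq_iff matrix_vector_mult_def wedge_def inner_vec_def algebra_simps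
      sum_subtractf sum_distrib_left sum_distrib_right)

lemma wedge3_wedge_common: "wedge3 (wedge s w) (c *\<^sub>R s) = 0"
  by (simp add: wedge3_def wedge_def vec_eq_iff algebra_simps)

lemma wedge4_dependent:
  fixes b c d :: "real ^ 'm::finite"
  shows
    "wedge4 (wedge3 (wedge (x *\<^sub>R b + y *\<^sub>R c + z *\<^sub>R d) b) c) d = 0"
    "wedge4 (wedge3 (wedge b (x *\<^sub>R b + y *\<^sub>R c + z *\<^sub>R d)) c) d = 0"
    "wedge4 (wedge3 (wedge b c) (x *\<^sub>R b + y *\<^sub>R c + z *\<^sub>R d)) d = 0"
    "wedge4 (wedge3 (wedge b c) d) (x *\<^sub>R b + y *\<^sub>R c + z *\<^sub>R d) = 0"
  by (simp_all add: wedge4_def wedge3_def wedge_def vec_eq_iff algebra_simps)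

lemma wedge4_independent:
  fixes a b c d :: "real ^ 'm::finite"
  assumes nz: "wedge4 (wedge3 (wedge a b) c) d \<noteq> 0"
    and rel: "p *\<^sub>R a + q *\<^sub>R b + r *\<^sub>R c + s *\<^sub>R d = 0"
  shows "p = 0 \<and> q = 0 \<and> r = 0 \<and> s = 0"
proof -
  have solve: "u = (- (x / t)) *\<^sub>R v + (- (y / t)) *\<^sub>R w + (- (z / t)) *\<^sub>R v'"
    if "t *\<^sub>R u + (x *\<^sub>R v + y *\<^sub>R w + z *\<^sub>R v') = 0" "t \<noteq> 0"
    for u v w v' :: "real ^ 'm" and t x y z
  proof -
    have "t *\<^sub>R u = - (x *\<^sub>R v + y *\<^sub>R w + z *\<^sub>R v')"
      using that(1) by (simp only: eq_neg_iff_add_eq_0)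
    then have "(1 / t) *\<^sub>R t *\<^sub>R u = (1 / t) *\<^sub>R (- (x *\<^sub>R v + y *\<^sub>R w + z *\<^sub>R v'))" by simp
    then show ?thesis using that(2) by (simp add: algebra_simps)
  qed
  have "p = 0"
  proof (rule ccontr)
    assume "p \<noteq> 0"
    then have "a = (- (q / p)) *\<^sub>R b + (- (r / p)) *\<^sub>R c + (- (s / p)) *\<^sub>R d"
      using solve[of p a q b r c s d] rel by (simp add: algebra_simps)
    then show False using nz wedge4_dependent(1) by blast
  qed
  moreover have "q = 0"
  proof (rule ccontr)
    assume "q \<noteq> 0"
    then have "b = (- (p / q)) *\<^sub>R a + (- (r / q)) *\<^sub>R c + (- (s / q)) *\<^sub>R d"
      using solve[of q b p a r c s d] rel by (simp add: algebra_simps)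
    then show False using nz wedge4_dependent(2) by blast
  qed
  moreover have "r = 0"
  proof (rule ccontr)
    assume "r \<noteq> 0"
    then have "c = (- (p / r)) *\<^sub>R a + (- (q / r)) *\<^sub>R b + (- (s / r)) *\<^sub>R d"
      using solve[of r c p a q b s d] rel by (simp add: algebra_simps)
    then show False using nz wedge4_dependent(3) by blast
  qed
  moreover have "s = 0"
  proof (rule ccontr)
    assume "s \<noteq> 0"
    then have "d = (- (p / s)) *\<^sub>R a + (- (q / s)) *\<^sub>R b + (- (r / s)) *\<^sub>R c"
      using solve[of s d p a q b r c] rel by (simp add: algebra_simps)
    then show False using nz wedge4_dependent(4) by blast
  qed
  ultimately show ?thesis by blast
qed

lemma curly_wedge_commute: "(\<alpha> \<curlywedge> \<beta>) l k j i = (\<beta> \<curlywedge> \<alpha>) l k j i"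
  unfolding curly_wedge_def
  by (subst (1 2) wedge_antisym) simp

text \<open>The form \<open>x \<wedge> dc\<close>, evaluated at the initial point of an edge or at its midpoint alike because
  \<open>dx \<wedge> dc = 0\<close>, has \<open>dx \<curlywedge> dc\<close> as its exterior derivative (Leibniz rule).\<close>

lemma curly_wedge_leibniz:
  assumes "wedge (dd x j i) (dd c j i) = 0" "wedge (dd x k j) (dd c k j) = 0"
    "wedge (dd x l k) (dd c l k) = 0" "wedge (dd x i l) (dd c i l) = 0"
  shows "wedge (x i) (dd c j i) + wedge (x j) (dd c k j) + wedge (x k) (dd c l k) + wedge (x l) (dd c i l)
    = (dd c \<curlywedge> dd x) l k j i"
proof -
  have "(wedge (x i) (dd c j i) + wedge (x j) (dd c k j) + wedge (x k) (dd c l k) + wedge (x l) (dd c i l))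
      $ a $ b = (dd c \<curlywedge> dd x) l k j i $ a $ b" for a b
  proof -
    have "wedge (dd x j i) (dd c j i) $ a $ b = 0" "wedge (dd x k j) (dd c k j) $ a $ b = 0"
      "wedge (dd x l k) (dd c l k) $ a $ b = 0" "wedge (dd x i l) (dd c i l) $ a $ b = 0"
      using assms by simp_all
    then show ?thesis
      unfolding curly_wedge_def dd_def wedge_def by (simp add: algebra_simps)
  qed
  then show ?thesis by (simp only: vec_eq_iff) simp
qed


section \<open>Dual nets with a common Gauss map\<close>

text \<open>All edges are measured by \<open>dn\<close>, which vanishes on no edge, whereas \<open>dx\<close> or \<open>dxc\<close> may vanish when a
  principal curvature is infinite. The coefficient \<open>\<rho>\<close> is the principal radius, with reversed sign, and in
  this form \<open>x\<close> and \<open>xc\<close> enter symmetrically.\<close>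

definition omega_dual ::
    "('N::finite) lattice set \<Rightarrow> ('N lattice \<Rightarrow> real ^ 3) \<Rightarrow> ('N lattice \<Rightarrow> real ^ 3) \<Rightarrow>
     ('N lattice \<Rightarrow> real ^ 3) \<Rightarrow> ('N lattice \<Rightarrow> real ^ 3) \<Rightarrow> bool" where
  "omega_dual \<Sigma> n nc x xc \<longleftrightarrow>
     (\<forall>i j. edge \<Sigma> i j \<longrightarrow> n i \<noteq> n j \<and>
        (\<exists>\<rho> A B. dd x j i = \<rho> *\<^sub>R dd n j i \<and> dd xc j i = A *\<^sub>R dd n j i \<and>
           dd nc j i = B *\<^sub>R dd n j i \<and> \<rho> * A + B \<noteq> 0)) \<and>
     (\<forall>i j k l. quad \<Sigma> i j k l \<longrightarrow> (dd xc \<curlywedge> dd x) l k j i + (dd nc \<curlywedge> dd n) l k j i = 0)"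

lemma omega_dual_sym: "omega_dual \<Sigma> n nc x xc \<Longrightarrow> omega_dual \<Sigma> n nc xc x"
  unfolding omega_dual_def curly_wedge_commute[of "dd x" "dd xc"]
  by (metis mult.commute)


section \<open>The Lie sphere form and contractions\<close>

text \<open>Flipping the negative coordinates turns the Lie form into the Euclidean inner product, so that
  Euclidean orthogonal complements become complements for the Lie form.\<close>

definition lie_flip :: "R42 \<Rightarrow> R42" where
  "lie_flip u = (\<chi> a. case a of Inl _ \<Rightarrow> u $ a | Inr _ \<Rightarrow> - (u $ a))"

lemma lie_flip_flip [simp]: "lie_flip (lie_flip u) = u"
  by (simp add: lie_flip_def vec_eq_iff split: sum.split)

lemma linear_lie_flip: "linear lie_flip"
  by (auto intro!: linearI simp: lie_flip_def vec_eq_iff split: sum.split)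

lemma lie_form_inner: "lie_form u v = lie_flip u \<bullet> v"
proof -
  have "lie_flip u \<bullet> v = (\<Sum>a\<in>UNIV <+> UNIV. lie_flip u $ a * v $ a)"
    by (simp add: inner_vec_def)
  also have "\<dots> = lie_form u v"
    unfolding lie_form_def by (subst sum.Plus) (simp_all add: lie_flip_def sum_negf)
  finally show ?thesis ..
qed

lemma lie_form_commute: "lie_form u v = lie_form v u"
  by (simp add: lie_form_def mult.commute)

lemma lie_form_inner': "lie_form u v = u \<bullet> lie_flip v"
  using lie_form_inner[of v u] by (simp add: lie_form_commute inner_commute)

lemma bilinear_lie_form: "bilinear lie_form"
  unfolding bilinear_def
proof (intro conjI allI)
  show 1: "linear (lie_form u)" for u
    by (auto intro!: linearI simp: lie_form_inner inner_right_distrib)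
  show "linear (\<lambda>u. lie_form u v)" for v
    using 1[of v] by (simp only: lie_form_commute[of _ v])
qed

lemmas lie_form_simps =
  bilinear_ladd[OF bilinear_lie_form] bilinear_radd[OF bilinear_lie_form]
  bilinear_lmul[OF bilinear_lie_form] bilinear_rmul[OF bilinear_lie_form]
  bilinear_lneg[OF bilinear_lie_form] bilinear_rneg[OF bilinear_lie_form]
  bilinear_lsub[OF bilinear_lie_form] bilinear_rsub[OF bilinear_lie_form]
  bilinear_lzero[OF bilinear_lie_form] bilinear_rzero[OF bilinear_lie_form]

definition contract :: "real ^ (4 + 2) ^ (4 + 2) \<Rightarrow> R42 \<Rightarrow> R42 \<Rightarrow> real" where
  "contract \<omega> u v = lie_flip u \<bullet> (\<omega> *v lie_flip v)"

lemma contract_wedge: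
  "contract (wedge a b) u v = lie_form a u * lie_form b v - lie_form b u * lie_form a v"
  by (simp add: contract_def wedge_mult_vector inner_diff_right lie_form_inner' inner_commute
      mult.commute)

lemma linear_contract: "linear (\<lambda>\<omega>. contract \<omega> u v)"
  by (auto intro!: linearI simp: contract_def matrix_vector_mult_add_rdistrib
      scaleR_matrix_vector_assoc[symmetric] inner_right_distrib)

lemmas contract_simps =
  linear_add[OF linear_contract] linear_cmul[OF linear_contract] linear_diff[OF linear_contract]
  linear_0[OF linear_contract] linear_neg[OF linear_contract]

lemma contract_add_left: "contract \<omega> (u + u') v = contract \<omega> u v + contract \<omega> u' v"
  by (simp add: contract_def linear_add[OF linear_lie_flip] inner_left_distrib)

lemma contract_scaleR_left: "contract \<omega> (c *\<^sub>R u) v = c * contract \<omega> u v"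
  by (simp add: contract_def linear_cmul[OF linear_lie_flip])

lemma contract_eq_0:
  assumes "\<And>u v. contract \<omega> u v = 0"
  shows "\<omega> = 0"
proof -
  have "\<omega> $ a $ b = 0" for a b
    using assms[of "lie_flip (axis a 1)" "lie_flip (axis b 1)"]
    by (simp add: contract_def inner_axis' matrix_vector_mult_basis column_def)
  then show ?thesis by (simp add: vec_eq_iff)
qed

lemma contract_Lambda2_antisym:
  assumes "\<omega> \<in> Lambda2 V"
  shows "contract \<omega> v u = - contract \<omega> u v"
  using assms unfolding Lambda2_def
proof (induction rule: span_induct)
  case base
  show ?case by (auto simp: subspace_def contract_simps algebra_simps)
next
  case (step \<omega>)
  then show ?case by (auto simp: contract_wedge)
qed

lemma contract_Lambda2_orthogonal:
  assumes "\<omega> \<in> Lambda2 V" and w: "\<And>v. v \<in> V \<Longrightarrow> lie_form v w = 0"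
  shows "contract \<omega> w u = 0"
  using assms(1) unfolding Lambda2_def
proof (induction rule: span_induct)
  case base
  show ?case by (auto simp: subspace_def contract_simps)
next
  case (step \<omega>)
  then show ?case using w by (auto simp: contract_wedge)
qed

text \<open>Contractions with vectors orthogonal to \<open>q\<close> determine a bivector up to a term \<open>q \<wedge> w\<close>, and such
  a term lies in \<open>\<Lambda>\<^sup>2V\<close> only if it vanishes or \<open>q \<in> V\<close>.\<close>

lemma Lambda2_eq_0:
  assumes V: "subspace V" and \<omega>: "\<omega> \<in> Lambda2 V" and q: "q \<notin> V"
    and perp: "\<And>u v. lie_form u q = 0 \<Longrightarrow> lie_form v q = 0 \<Longrightarrow> contract \<omega> u v = 0"
  shows "\<omega> = 0"
proof -
  obtain y z where y: "y \<in> span V" and z: "\<And>w. w \<in> span V \<Longrightarrow> orthogonal z w" and "q = y + z"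
    using orthogonal_subspace_decomp_exists[of V q] by metis
  have yV: "y \<in> V" using y V by (metis span_eq_iff)
  \<comment> \<open>a vector Lie-orthogonal to \<open>V\<close> but not to \<open>q\<close>, which complements the orthogonal space of \<open>q\<close>\<close>
  define w where "w = lie_flip z"
  have wV: "lie_form v w = 0" if "v \<in> V" for v
    using z[of v] that by (simp add: w_def lie_form_inner' orthogonal_def span_base inner_commute)
  have "z \<noteq> 0" using q yV \<open>q = y + z\<close> by auto
  have "lie_form w q = z \<bullet> y + z \<bullet> z"
    by (simp add: w_def lie_form_inner \<open>q = y + z\<close> inner_right_distrib)
  also have "z \<bullet> y = 0" using z[OF y] by (simp add: orthogonal_def)
  finally have wq: "lie_form w q \<noteq> 0" using \<open>z \<noteq> 0\<close> by simp
  have w0: "contract \<omega> w v = 0" for v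
    by (rule contract_Lambda2_orthogonal[OF \<omega> wV])
  have w0': "contract \<omega> v w = 0" for v
    using w0 contract_Lambda2_antisym[OF \<omega>, of v w] by simp
  have split: "\<exists>u' c. u = u' + c *\<^sub>R w \<and> lie_form u' q = 0" for u
    using wq by (intro exI[of _ "u - (lie_form u q / lie_form w q) *\<^sub>R w"]
        exI[of _ "lie_form u q / lie_form w q"]) (simp add: lie_form_simps)
  have half: "contract \<omega> u v = 0" if v: "lie_form v q = 0" for u v
  proof -
    obtain u' c where "u = u' + c *\<^sub>R w" "lie_form u' q = 0" using split by blast
    then show ?thesis using v perp by (simp add: contract_add_left contract_scaleR_left w0)
  qed
  have "contract \<omega> u v = 0" for u v
  proof -
    obtain u' c where u: "u = u' + c *\<^sub>R w" "lie_form u' q = 0" using split by blast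
    then have "contract \<omega> u v = contract \<omega> u' v"
      by (simp add: contract_add_left contract_scaleR_left w0)
    also have "\<dots> = - contract \<omega> v u'" using contract_Lambda2_antisym[OF \<omega>] by blast
    finally show ?thesis using half u by simp
  qed
  then show ?thesis by (rule contract_eq_0)
qed

text \<open>The left-hand side is the contraction of \<open>a \<and> b \<and> c\<close> with \<open>w\<close> in the last argument.\<close>

lemma wedge3_eq_0_contract:
  assumes "wedge3 (wedge a b) c = 0"
  shows "lie_form c w *\<^sub>R wedge a b + lie_form a w *\<^sub>R wedge b c + lie_form b w *\<^sub>R wedge c a = 0"
proof -
  let ?f = "lie_flip w"
  have lf: "lie_form u w = (\<Sum>k\<in>UNIV. u $ k * ?f $ k)" for u
    by (simp add: lie_form_inner' inner_vec_def)
  have "(lie_form c w *\<^sub>R wedge a b + lie_form a w *\<^sub>R wedge b c + lie_form b w *\<^sub>R wedge c a) $ i $ j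
      = (\<Sum>k\<in>UNIV. wedge3 (wedge a b) c $ i $ j $ k * ?f $ k)" for i j
    by (simp add: lf wedge_def wedge3_def sum_distrib_right sum_distrib_left algebra_simps
        flip: sum.distrib sum_subtractf)
  then show ?thesis using assms by (simp add: vec_eq_iff)
qed

lemma Lambda2_three_vectors:
  assumes "\<omega> \<in> Lambda2 W" and W: "\<And>w. w \<in> W \<Longrightarrow> \<exists>\<alpha> \<beta> \<gamma>. w = \<alpha> *\<^sub>R Y + \<beta> *\<^sub>R T + \<gamma> *\<^sub>R D"
  shows "\<exists>a A B. \<omega> = a *\<^sub>R wedge Y T + wedge (A *\<^sub>R Y + B *\<^sub>R T) D"
  using assms(1) unfolding Lambda2_def
proof (induction rule: span_induct)
  case base
  let ?P = "\<lambda>\<omega>. \<exists>a A B. \<omega> = a *\<^sub>R wedge Y T + wedge (A *\<^sub>R Y + B *\<^sub>R T) D"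
  have "?P 0"
    by (intro exI[of _ 0]) (simp add: wedge_simps)
  moreover have "?P (\<omega> + \<omega>')" if sum: "?P \<omega>" "?P \<omega>'" for \<omega> \<omega>'
  proof -
    obtain a A B a' A' B' where "\<omega> = a *\<^sub>R wedge Y T + wedge (A *\<^sub>R Y + B *\<^sub>R T) D"
      "\<omega>' = a' *\<^sub>R wedge Y T + wedge (A' *\<^sub>R Y + B' *\<^sub>R T) D"
      using sum by blast
    then have "\<omega> + \<omega>' = (a + a') *\<^sub>R wedge Y T + wedge ((A + A') *\<^sub>R Y + (B + B') *\<^sub>R T) D"
      by (simp add: wedge_simps algebra_simps)
    then show ?thesis by blast
  qed
  moreover have "?P (t *\<^sub>R \<omega>)" if scale: "?P \<omega>" for t \<omega>
  proof -
    obtain a A B where "\<omega> = a *\<^sub>R wedge Y T + wedge (A *\<^sub>R Y + B *\<^sub>R T) D"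
      using scale by blast
    then have "t *\<^sub>R \<omega> = (t * a) *\<^sub>R wedge Y T + wedge ((t * A) *\<^sub>R Y + (t * B) *\<^sub>R T) D"
      by (simp add: wedge_simps algebra_simps)
    then show ?thesis by blast
  qed
  ultimately show ?case by (simp add: subspace_def)
next
  case (step \<omega>)
  then obtain \<alpha> \<beta> \<gamma> \<alpha>' \<beta>' \<gamma>' where
    "\<omega> = wedge (\<alpha> *\<^sub>R Y + \<beta> *\<^sub>R T + \<gamma> *\<^sub>R D) (\<alpha>' *\<^sub>R Y + \<beta>' *\<^sub>R T + \<gamma>' *\<^sub>R D)"
    using W by blast
  then have "\<omega> = (\<alpha> * \<beta>' - \<beta> * \<alpha>') *\<^sub>R wedge Y T
      + wedge ((\<alpha> * \<gamma>' - \<gamma> * \<alpha>') *\<^sub>R Y + (\<beta> * \<gamma>' - \<gamma> * \<beta>') *\<^sub>R T) D"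
    by (simp add: vec_eq_iff wedge_def algebra_simps)
  then show ?case by blast
qed


section \<open>Lifts of contact elements\<close>

locale lie_sphere_frame =
  fixes \<oo> \<qq> \<pp> :: R42 and \<iota> :: "real ^ 3 \<Rightarrow> R42"
  assumes frame: "lie_frame \<oo> \<qq> \<pp> \<iota>"
begin

lemma frame_products [simp]:
  "lie_form \<pp> \<pp> = -1" "lie_form \<oo> \<oo> = 0" "lie_form \<qq> \<qq> = 0" "lie_form \<oo> \<qq> = -1"
  "lie_form \<qq> \<oo> = -1" "lie_form \<oo> \<pp> = 0" "lie_form \<qq> \<pp> = 0" "lie_form \<pp> \<oo> = 0" "lie_form \<pp> \<qq> = 0"
  "lie_form (\<iota> u) (\<iota> v) = u \<bullet> v"
  "lie_form (\<iota> u) \<oo> = 0" "lie_form (\<iota> u) \<qq> = 0" "lie_form (\<iota> u) \<pp> = 0"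
  "lie_form \<oo> (\<iota> u) = 0" "lie_form \<qq> (\<iota> u) = 0" "lie_form \<pp> (\<iota> u) = 0"
  using frame unfolding lie_frame_def by (simp_all add: lie_form_commute)

lemma infinity_nonzero: "\<qq> \<noteq> 0"
proof
  assume "\<qq> = 0"
  then have "lie_form \<oo> \<qq> = lie_form \<oo> 0" by simp
  then show False by (simp add: lie_form_simps)
qed

lemma linear_embed: "linear \<iota>"
  using frame unfolding lie_frame_def by blast

lemmas embed_simps = linear_add[OF linear_embed] linear_cmul[OF linear_embed]
  linear_diff[OF linear_embed] linear_neg[OF linear_embed] linear_0[OF linear_embed]

lemma frame_coordinates:
  assumes "u = a *\<^sub>R \<oo> + b *\<^sub>R \<qq> + c *\<^sub>R \<pp> + \<iota> v"
  shows "lie_form u \<qq> = - a" "lie_form u \<oo> = - b" "lie_form u \<pp> = - c" "lie_form u (\<iota> e) = v \<bullet> e"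
  by (simp_all add: assms lie_form_simps)

lemma frame_spans: "\<exists>a b c v. u = a *\<^sub>R \<oo> + b *\<^sub>R \<qq> + c *\<^sub>R \<pp> + \<iota> v"
proof -
  define g :: "real \<times> real \<times> real \<times> (real ^ 3) \<Rightarrow> R42" where
    "g = (\<lambda>(a, b, c, v). a *\<^sub>R \<oo> + b *\<^sub>R \<qq> + c *\<^sub>R \<pp> + \<iota> v)"
  have lin: "linear g"
    by (auto intro!: linearI simp: g_def embed_simps algebra_simps)
  have "inj g"
  proof (rule linear_injective_0[OF lin, THEN iffD2], clarify)
    fix a b c v assume "g (a, b, c, v) = 0"
    then have "0 = a *\<^sub>R \<oo> + b *\<^sub>R \<qq> + c *\<^sub>R \<pp> + \<iota> v" by (simp add: g_def)
    note * = frame_coordinates[OF this]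
    from * show "(a, b, c, v) = 0"
      by (simp add: lie_form_simps zero_prod_def) (metis inner_eq_zero_iff)
  qed
  then have "dim (range g) = dim (UNIV :: (real \<times> real \<times> real \<times> (real ^ 3)) set)"
    using lin by (intro dim_image_eq) auto
  then have "span (range g) = UNIV"
    by (subst dim_eq_full[symmetric]) simp
  then have "u \<in> range g"
    using linear_subspace_image[OF lin subspace_UNIV] by (metis UNIV_I span_eq_iff)
  then show ?thesis by (auto simp: g_def)
qed

definition point_lift :: "real ^ 3 \<Rightarrow> R42" where
  "point_lift a = \<oo> + \<iota> a + ((a \<bullet> a) / 2) *\<^sub>R \<qq>"

definition plane_lift :: "real ^ 3 \<Rightarrow> real ^ 3 \<Rightarrow> R42" where
  "plane_lift a m = \<iota> m + \<pp> + (a \<bullet> m) *\<^sub>R \<qq>"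

abbreviation lift :: "('v \<Rightarrow> real ^ 3) \<Rightarrow> ('v \<Rightarrow> real ^ 3) \<Rightarrow> 'v \<Rightarrow> R42 set" where
  "lift \<equiv> legendre_lift \<oo> \<qq> \<pp> \<iota>"

lemma lift_eq: "lift x n i = span {point_lift (x i), plane_lift (x i) (n i)}"
  by (simp add: legendre_lift_def point_lift_def plane_lift_def)

lemma lift_mem: "point_lift (x i) \<in> lift x n i" "plane_lift (x i) (n i) \<in> lift x n i"
  by (simp_all add: lift_eq span_base)

lemma lift_iff:
  "w \<in> lift x n i \<longleftrightarrow> (\<exists>\<alpha> \<beta>. w = \<alpha> *\<^sub>R point_lift (x i) + \<beta> *\<^sub>R plane_lift (x i) (n i))"
proof -
  have "w \<in> lift x n i \<longleftrightarrow>
      (\<exists>\<alpha> \<beta>. w - \<alpha> *\<^sub>R point_lift (x i) = \<beta> *\<^sub>R plane_lift (x i) (n i))"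
    by (auto simp: lift_eq span_insert span_empty)
  then show ?thesis by (simp add: algebra_simps)
qed

lemma lift_products [simp]:
  "lie_form (point_lift a) \<qq> = -1" "lie_form (point_lift a) \<pp> = 0"
  "lie_form (point_lift a) (\<iota> e) = a \<bullet> e"
  "lie_form (plane_lift a m) \<qq> = 0" "lie_form (plane_lift a m) \<pp> = -1"
  "lie_form (plane_lift a m) (\<iota> e) = m \<bullet> e"
  by (simp_all add: point_lift_def plane_lift_def lie_form_simps)

lemma lift_isotropic:
  "lie_form (point_lift a) (point_lift a) = 0"
  "lie_form (point_lift a) (plane_lift a m) = 0"
  "m \<bullet> m = 1 \<Longrightarrow> lie_form (plane_lift a m) (plane_lift a m) = 0"
  by (simp_all add: point_lift_def plane_lift_def lie_form_simps)

text \<open>The point sphere and the tangent plane move along an edge in the same direction, since the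
  contact elements share the sphere \<open>y - \<rho>t\<close>; the hypothesis on norms makes the two \<open>q\<close>-components agree.\<close>

lemma point_lift_diff:
  assumes "b - a = \<rho> *\<^sub>R (k - m)" "m \<bullet> m = k \<bullet> k"
  shows "point_lift b - point_lift a = \<rho> *\<^sub>R (plane_lift b k - plane_lift a m)"
proof -
  have orth: "(b - a) \<bullet> (k + m) = 0"
    using assms by (simp add: inner_diff_left inner_diff_right inner_add_right inner_commute)
  have "b \<bullet> b - a \<bullet> a = (b - a) \<bullet> (b + a)"
    by (simp add: inner_diff_left inner_diff_right inner_add_right inner_commute)
  also have "\<dots> = \<rho> * ((k - m) \<bullet> (b + a))"
    by (simp add: assms(1))
  also have "(k - m) \<bullet> (b + a) = 2 * (b \<bullet> k - a \<bullet> m) - (b - a) \<bullet> (k + m)"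
    by (simp add: inner_diff_left inner_diff_right inner_add_right inner_commute)
  finally have "b \<bullet> b - a \<bullet> a = 2 * (\<rho> * (b \<bullet> k - a \<bullet> m))"
    by (simp add: orth)
  then have q: "(b \<bullet> b) / 2 - (a \<bullet> a) / 2 = \<rho> * (b \<bullet> k - a \<bullet> m)"
    by linarith
  have "point_lift b - point_lift a = \<iota> (b - a) + ((b \<bullet> b) / 2 - (a \<bullet> a) / 2) *\<^sub>R \<qq>"
    by (simp add: point_lift_def embed_simps algebra_simps)
  also have "\<dots> = \<rho> *\<^sub>R (\<iota> (k - m) + (b \<bullet> k - a \<bullet> m) *\<^sub>R \<qq>)"
    unfolding q assms(1) by (simp add: embed_simps algebra_simps)
  also have "\<iota> (k - m) + (b \<bullet> k - a \<bullet> m) *\<^sub>R \<qq> = plane_lift b k - plane_lift a m"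
    by (simp add: plane_lift_def embed_simps algebra_simps)
  finally show ?thesis .
qed

lemma plane_lift_diff_product:
  "lie_form (plane_lift b k - plane_lift a m) \<qq> = 0"
  "lie_form (plane_lift b k - plane_lift a m) \<pp> = 0"
  "lie_form (plane_lift b k - plane_lift a m) (\<iota> e) = (k - m) \<bullet> e"
  by (simp_all add: lie_form_simps inner_diff_left)

text \<open>The products with \<open>q\<close> and \<open>p\<close> read off the two coefficients, independently of the base point.\<close>

lemma lift_coefficients:
  assumes "\<alpha> *\<^sub>R point_lift a + \<beta> *\<^sub>R plane_lift a m = \<gamma> *\<^sub>R point_lift b + \<delta> *\<^sub>R plane_lift b k + w"
    and "lie_form w \<qq> = 0" "lie_form w \<pp> = 0"
  shows "\<alpha> = \<gamma>" "\<beta> = \<delta>"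
  using arg_cong[OF assms(1), of "\<lambda>v. lie_form v \<qq>"] arg_cong[OF assms(1), of "\<lambda>v. lie_form v \<pp>"]
    assms(2,3) by (simp_all add: lie_form_simps)


section \<open>Nets and their lifts\<close>

lemma lift_edge:
  assumes "omega_dual \<Sigma> n nc x xc" "\<forall>i\<in>\<Sigma>. n i \<bullet> n i = 1" "edge \<Sigma> i j"
  obtains \<rho> A B where "dd x j i = \<rho> *\<^sub>R dd n j i" "dd xc j i = A *\<^sub>R dd n j i"
    "dd nc j i = B *\<^sub>R dd n j i" "\<rho> * A + B \<noteq> 0" "dd n j i \<noteq> 0"
    "point_lift (x j) - point_lift (x i) = \<rho> *\<^sub>R (plane_lift (x j) (n j) - plane_lift (x i) (n i))"
proof -
  have ij: "i \<in> \<Sigma>" "j \<in> \<Sigma>" using assms(3) by (auto simp: edge_def)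
  obtain \<rho> A B where *: "dd x j i = \<rho> *\<^sub>R dd n j i" "dd xc j i = A *\<^sub>R dd n j i"
    "dd nc j i = B *\<^sub>R dd n j i" "\<rho> * A + B \<noteq> 0" "n i \<noteq> n j"
    using assms(1,3) unfolding omega_dual_def by blast
  have "point_lift (x j) - point_lift (x i) = \<rho> *\<^sub>R (plane_lift (x j) (n j) - plane_lift (x i) (n i))"
    using * assms(2) ij by (intro point_lift_diff) (auto simp: dd_def)
  then show ?thesis using * that by (auto simp: dd_def)
qed

lemma lift_dim: "dim (lift x n i) = 2"
proof -
  let ?Y = "point_lift (x i)" and ?T = "plane_lift (x i) (n i)"
  have indep: "\<alpha> = 0 \<and> \<beta> = 0" if "\<alpha> *\<^sub>R ?Y + \<beta> *\<^sub>R ?T = 0" for \<alpha> \<beta>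
    using lift_coefficients[of \<alpha> "x i" \<beta> "n i" 0 "x i" 0 "n i" 0] that by (simp add: lie_form_simps)
  have "?Y \<notin> span {?T}"
  proof
    assume "?Y \<in> span {?T}"
    then obtain c where "?Y = c *\<^sub>R ?T" by (auto simp: span_singleton)
    then have "1 *\<^sub>R ?Y + (- c) *\<^sub>R ?T = 0" by simp
    then show False using indep by fastforce
  qed
  moreover have "?T \<noteq> 0" using indep[of 0 1] by auto
  ultimately have "independent {?Y, ?T}"
    by (simp add: independent_insert)
  moreover have "?Y \<noteq> ?T" using indep[of 1 "-1"] by auto
  ultimately show ?thesis
    by (simp add: lift_eq dim_eq_card_independent)
qed

lemma legendre_map_lift:
  assumes "omega_dual \<Sigma> n nc x xc" "\<forall>i\<in>\<Sigma>. n i \<bullet> n i = 1"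
  shows "legendre_map \<Sigma> (lift x n)"
  unfolding legendre_map_def
proof (intro conjI ballI allI impI)
  fix i assume i: "i \<in> \<Sigma>"
  show "subspace (lift x n i)" by (simp add: lift_eq)
  show "dim (lift x n i) = 2" by (rule lift_dim)
  fix u v assume "u \<in> lift x n i" "v \<in> lift x n i"
  then show "lie_form u v = 0"
    using i assms(2) lie_form_commute[of "plane_lift (x i) (n i)" "point_lift (x i)"]
    by (auto simp: lift_iff lie_form_simps lift_isotropic)
next
  fix i j assume "edge \<Sigma> i j"
  then obtain \<rho> where
    "point_lift (x j) - point_lift (x i) = \<rho> *\<^sub>R (plane_lift (x j) (n j) - plane_lift (x i) (n i))"
    using lift_edge[OF assms] by metis
  then have eq: "1 *\<^sub>R point_lift (x i) + (- \<rho>) *\<^sub>R plane_lift (x i) (n i)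
      = 1 *\<^sub>R point_lift (x j) + (- \<rho>) *\<^sub>R plane_lift (x j) (n j)"
    by (simp add: algebra_simps)
  let ?s = "1 *\<^sub>R point_lift (x i) + (- \<rho>) *\<^sub>R plane_lift (x i) (n i)"
  have "?s \<in> lift x n i" "?s \<in> lift x n j"
    unfolding lift_iff using eq by blast+
  moreover have "?s \<noteq> 0"
    using lift_products(1) by (metis lift_coefficients(1)[of 1 "x i" "- \<rho>" "n i" 0 "x i" 0 "n i" 0]
        add_0 bilinear_lzero[OF bilinear_lie_form] scaleR_zero_left zero_neq_one add_0_right)
  ultimately show "lift x n i \<inter> lift x n j \<noteq> {0}" by blast
qed

lemma lift_subset_span:
  assumes a: "a \<in> lift x n i" and d: "d \<in> lift x n i"
    and indep: "\<And>p q. p *\<^sub>R a + q *\<^sub>R d = 0 \<Longrightarrow> p = 0 \<and> q = 0"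
  shows "lift x n i \<subseteq> span {a, d}"
proof -
  let ?Y = "point_lift (x i)" and ?T = "plane_lift (x i) (n i)"
  obtain \<alpha> \<beta> \<gamma> \<delta> where a': "a = \<alpha> *\<^sub>R ?Y + \<beta> *\<^sub>R ?T" and d': "d = \<gamma> *\<^sub>R ?Y + \<delta> *\<^sub>R ?T"
    using a d by (auto simp: lift_iff)
  define \<Delta> where "\<Delta> = \<alpha> * \<delta> - \<beta> * \<gamma>"
  have Y: "\<Delta> *\<^sub>R ?Y = \<delta> *\<^sub>R a + (- \<beta>) *\<^sub>R d" and T: "\<Delta> *\<^sub>R ?T = (- \<gamma>) *\<^sub>R a + \<alpha> *\<^sub>R d"
    by (simp_all add: a' d' \<Delta>_def algebra_simps)
  have "\<Delta> \<noteq> 0"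
  proof
    assume "\<Delta> = 0"
    then have "\<alpha> = 0" "\<beta> = 0" using indep[of \<delta> "- \<beta>"] indep[of "- \<gamma>" \<alpha>] Y T by simp_all
    then show False using indep[of 1 0] a' by simp
  qed
  have mem: "\<Delta> *\<^sub>R ?Y \<in> span {a, d}" "\<Delta> *\<^sub>R ?T \<in> span {a, d}"
    unfolding Y T by (intro span_add span_scale span_base; simp)+
  then have "?Y \<in> span {a, d}" "?T \<in> span {a, d}"
    using span_scale[OF mem(1), of "1 / \<Delta>"] span_scale[OF mem(2), of "1 / \<Delta>"] \<open>\<Delta> \<noteq> 0\<close> by simp_all
  then show ?thesis unfolding lift_eq by (intro span_minimal) auto
qed

text \<open>Each contact element contains two consecutive ones of the four shared spheres, and regularity
  makes these independent, so the four shared spheres span all contact elements of the quadrilateral.\<close>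

lemma regular_quad_span:
  assumes "regular_map \<Sigma> (lift x n)" "quad \<Sigma> i j k l"
  obtains V where "subspace V" "dim V \<le> 4"
    "lift x n i \<subseteq> V" "lift x n j \<subseteq> V" "lift x n k \<subseteq> V" "lift x n l \<subseteq> V"
proof -
  obtain a b c d where mem: "a \<in> lift x n i" "a \<in> lift x n j" "b \<in> lift x n j" "b \<in> lift x n k"
      "c \<in> lift x n k" "c \<in> lift x n l" "d \<in> lift x n l" "d \<in> lift x n i"
    and nz: "wedge4 (wedge3 (wedge a b) c) d \<noteq> 0"
    using assms unfolding regular_map_def edge_meet_def by blast
  note indep = wedge4_independent[OF nz]
  define V where "V = span {a, b, c, d}"
  have "lift x n i \<subseteq> span {a, d}"
    using mem indep[of _ 0 0] by (intro lift_subset_span) auto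
  moreover have "lift x n j \<subseteq> span {a, b}"
    using mem indep[of _ _ 0 0] by (intro lift_subset_span) auto
  moreover have "lift x n k \<subseteq> span {b, c}"
    using mem indep[of 0 _ _ 0] by (intro lift_subset_span) auto
  moreover have "lift x n l \<subseteq> span {c, d}"
    using mem indep[of 0 0] by (intro lift_subset_span) auto
  moreover have "span {a, d} \<subseteq> V" "span {a, b} \<subseteq> V" "span {b, c} \<subseteq> V" "span {c, d} \<subseteq> V"
    unfolding V_def by (intro span_mono; simp)+
  moreover have "dim V \<le> card {a, b, c, d}"
    using dim_le_card'[of "{a, b, c, d}"] by (simp add: V_def)
  moreover have "card {a, b, c, d} \<le> 4"
    by (simp add: card_insert_if)
  ultimately show ?thesis
    by (intro that[of V]) (auto simp: V_def)
qed


text \<open>Otherwise \<open>V\<close> would contain the five independent vectors \<open>y\<^sub>i\<close>, \<open>t\<^sub>i\<close>, \<open>q\<close> and two differences of tangent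
  planes whose parts in \<open>\<real>\<^sup>3\<close>, differences of normals, are not parallel.\<close>

lemma infinity_not_in_span:
  assumes V: "subspace V" "dim V \<le> 4"
    and lifts: "\<And>m. m \<in> {i, j, k, l} \<Longrightarrow> lift x n m \<subseteq> V"
    and ij: "n i \<noteq> n j" and nc: "\<not> collinear {n i, n j, n k, n l}"
  shows "\<qq> \<notin> V"
proof
  assume q: "\<qq> \<in> V"
  define Y T where "Y = point_lift (x i)" and "T m = plane_lift (x m) (n m)" for m
  have Y: "Y \<in> V"
    unfolding Y_def by (rule subsetD[OF lifts lift_mem(1)]) simp
  have T: "T m \<in> V" if "m \<in> {i, j, k, l}" for m
    unfolding T_def by (rule subsetD[OF lifts[OF that] lift_mem(2)])
  have multiple: "\<exists>c. n m - n i = c *\<^sub>R (n j - n i)" if m: "m \<in> {i, j, k, l}" for m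
  proof (rule ccontr)
    assume no: "\<nexists>c. n m - n i = c *\<^sub>R (n j - n i)"
    have indep: "c = 0 \<and> d = 0" if "c *\<^sub>R (n j - n i) + d *\<^sub>R (n m - n i) = 0" for c d
    proof -
      have "d = 0"
      proof (rule ccontr)
        assume "d \<noteq> 0"
        have "d *\<^sub>R (n m - n i) = (- c) *\<^sub>R (n j - n i)"
          using that by (simp only: scaleR_minus_left eq_neg_iff_add_eq_0 add.commute)
        then have "(1 / d) *\<^sub>R d *\<^sub>R (n m - n i) = (1 / d) *\<^sub>R (- c) *\<^sub>R (n j - n i)" by (simp only:)
        then have "n m - n i = ((1 / d) * (- c)) *\<^sub>R (n j - n i)"
          using \<open>d \<noteq> 0\<close> by simp
        then show False using no by blast
      qed
      then show ?thesis using that ij by simp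
    qed
    define g :: "real \<times> real \<times> real \<times> real \<times> real \<Rightarrow> R42" where
      "g = (\<lambda>(a, b, c, d, e). a *\<^sub>R Y + b *\<^sub>R T i + c *\<^sub>R (T j - T i) + d *\<^sub>R (T m - T i) + e *\<^sub>R \<qq>)"
    have lin: "linear g"
      by (auto intro!: linearI simp: g_def algebra_simps)
    have "inj g"
    proof (rule linear_injective_0[OF lin, THEN iffD2], clarify)
      fix a b c d e assume g0: "g (a, b, c, d, e) = 0"
      have prod: "lie_form (g (a, b, c, d, e)) \<qq> = - a" "lie_form (g (a, b, c, d, e)) \<pp> = - b"
        "lie_form (g (a, b, c, d, e)) (\<iota> v)
          = a * (x i \<bullet> v) + b * (n i \<bullet> v) + (c *\<^sub>R (n j - n i) + d *\<^sub>R (n m - n i)) \<bullet> v" for v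
        by (simp_all add: g_def Y_def T_def lie_form_simps algebra_simps)
      have "a = 0" "b = 0" using prod(1,2) g0 by (simp_all add: lie_form_simps)
      moreover have "c *\<^sub>R (n j - n i) + d *\<^sub>R (n m - n i) = 0"
        using prod(3)[of "c *\<^sub>R (n j - n i) + d *\<^sub>R (n m - n i)"] g0 \<open>a = 0\<close> \<open>b = 0\<close>
        by (simp add: lie_form_simps)
      then have "c = 0" "d = 0" using indep by blast+
      moreover have "e = 0"
        using infinity_nonzero g0 \<open>a = 0\<close> \<open>b = 0\<close> \<open>c = 0\<close> \<open>d = 0\<close>
        by (auto simp: g_def lie_form_simps)
      ultimately show "(a, b, c, d, e) = 0" by (simp add: zero_prod_def)
    qed
    then have "dim (range g) = dim (UNIV :: (real \<times> real \<times> real \<times> real \<times> real) set)"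
      using lin by (intro dim_image_eq) auto
    moreover have "range g \<subseteq> V"
      using q Y T m V(1) by (auto simp: g_def intro!: subspace_add subspace_scale subspace_diff)
    then have "dim (range g) \<le> dim V" by (rule dim_subset)
    ultimately show False using V(2) by simp
  qed
  have "collinear {n i, n j, n k, n l}"
    unfolding collinear_def
  proof (rule exI[of _ "n j - n i"], intro ballI)
    fix v w assume "v \<in> {n i, n j, n k, n l}" "w \<in> {n i, n j, n k, n l}"
    then obtain c d where cd: "v - n i = c *\<^sub>R (n j - n i)" "w - n i = d *\<^sub>R (n j - n i)"
      using multiple by blast
    have "v - w = (v - n i) - (w - n i)" by simp
    also have "\<dots> = (c - d) *\<^sub>R (n j - n i)"
      unfolding cd by (simp add: scaleR_left_diff_distrib)
    finally have "v - w = (c - d) *\<^sub>R (n j - n i)" .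
    then show "\<exists>c. v - w = c *\<^sub>R (n j - n i)" by blast
  qed
  then show False using nc by blast
qed

text \<open>The vectors used here fill the orthogonal space of \<open>q\<close>. The first two terms are the values of an
  exact form, the other two those of \<open>x \<and> dxc\<close> and \<open>n \<and> dnc\<close>.\<close>

lemma contract_edge:
  assumes xc: "dd xc s r = A *\<^sub>R dd n s r" and nc: "dd nc s r = B *\<^sub>R dd n s r"
  shows "contract (wedge (A *\<^sub>R point_lift (x r) + B *\<^sub>R plane_lift (x r) (n r))
        (plane_lift (x s) (n s) - plane_lift (x r) (n r)))
      (b *\<^sub>R \<qq> + c *\<^sub>R \<pp> + \<iota> e) (b' *\<^sub>R \<qq> + c' *\<^sub>R \<pp> + \<iota> e')
    = dd xc s r \<bullet> (b' *\<^sub>R e - b *\<^sub>R e') + dd nc s r \<bullet> (c' *\<^sub>R e - c *\<^sub>R e')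
      + e \<bullet> (wedge (x r) (dd xc s r) *v e') + e \<bullet> (wedge (n r) (dd nc s r) *v e')"
proof -
  have D: "lie_form (plane_lift (x s) (n s) - plane_lift (x r) (n r)) (b *\<^sub>R \<qq> + c *\<^sub>R \<pp> + \<iota> e)
      = dd n s r \<bullet> e" for b c e
    by (simp only: bilinear_radd[OF bilinear_lie_form] bilinear_rmul[OF bilinear_lie_form]
        plane_lift_diff_product dd_def) simp
  have P: "lie_form (A *\<^sub>R point_lift (x r) + B *\<^sub>R plane_lift (x r) (n r)) (b *\<^sub>R \<qq> + c *\<^sub>R \<pp> + \<iota> e)
      = A * (x r \<bullet> e - b) + B * (n r \<bullet> e - c)" for b c e
    by (simp add: lie_form_simps algebra_simps)
  show ?thesis
    unfolding contract_wedge D P xc nc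
    by (simp add: wedge_simps wedge_mult_vector scaleR_matrix_vector_assoc[symmetric]
        inner_diff_right inner_commute algebra_simps)
qed

text \<open>By the previous lemma and the Leibniz rule the derivative of \<open>(A y + B t) \<and> dt\<close> is annihilated by
  contraction with vectors orthogonal to \<open>q\<close>, and \<open>q\<close> is outside the span of the contact elements.\<close>

lemma applicable_lift:
  assumes dual: "omega_dual \<Sigma> n nc x xc" and unit: "\<forall>i\<in>\<Sigma>. n i \<bullet> n i = 1"
    and regular: "regular_map \<Sigma> (lift x n)" and noncol: "noncollinear_quads \<Sigma> n"
  shows "applicable \<Sigma> (lift x n)"
proof -
  define Y T where "Y m = point_lift (x m)" and "T m = plane_lift (x m) (n m)" for m
  \<comment> \<open>the coefficients as quotients of inner products, which makes them symmetric in the end-points\<close>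
  define A B where "A j i = (dd xc j i \<bullet> dd n j i) / (dd n j i \<bullet> dd n j i)"
    and "B j i = (dd nc j i \<bullet> dd n j i) / (dd n j i \<bullet> dd n j i)" for j i
  define \<eta> where "\<eta> j i = wedge (A j i *\<^sub>R Y i + B j i *\<^sub>R T i) (T j - T i)" for j i
  have mem: "Y m \<in> lift x n m" "T m \<in> lift x n m" for m
    unfolding Y_def T_def by (fact lift_mem)+
  have E: "\<exists>\<rho>. dd x j i = \<rho> *\<^sub>R dd n j i \<and> dd xc j i = A j i *\<^sub>R dd n j i \<and> dd nc j i = B j i *\<^sub>R dd n j i
      \<and> \<rho> * A j i + B j i \<noteq> 0 \<and> dd n j i \<noteq> 0 \<and> Y j - Y i = \<rho> *\<^sub>R (T j - T i)" if e: "edge \<Sigma> i j" for i j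
  proof -
    obtain \<rho> A' B' where *: "dd x j i = \<rho> *\<^sub>R dd n j i" "dd xc j i = A' *\<^sub>R dd n j i"
      "dd nc j i = B' *\<^sub>R dd n j i" "\<rho> * A' + B' \<noteq> 0" "dd n j i \<noteq> 0" "Y j - Y i = \<rho> *\<^sub>R (T j - T i)"
      by (rule lift_edge[OF dual unit e, folded Y_def T_def])
    then have "A j i = A'" "B j i = B'" by (simp_all add: A_def B_def)
    then show ?thesis using * by blast
  qed
  have sym: "A i j = A j i" "B i j = B j i" for i j
  proof -
    have odd: "dd u i j = - dd u j i" for u :: "'a lattice \<Rightarrow> real ^ 3" by (simp add: dd_def)
    show "A i j = A j i" "B i j = B j i"
      unfolding A_def B_def odd by simp_all
  qed
  have "one_form \<Sigma> \<eta>"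
    unfolding one_form_def
  proof (intro allI impI)
    fix i j assume "edge \<Sigma> i j"
    then obtain \<rho> where \<rho>: "Y j - Y i = \<rho> *\<^sub>R (T j - T i)" using E by blast
    define D where "D = T j - T i"
    have "Y j = Y i + \<rho> *\<^sub>R D" using \<rho> unfolding D_def[symmetric] by (simp add: algebra_simps)
    moreover have "T j = T i + D" by (simp add: D_def)
    ultimately show "\<eta> j i = - \<eta> i j"
      unfolding \<eta>_def sym[of i j] by (simp add: vec_eq_iff wedge_def algebra_simps)
  qed
  moreover have "closed_form \<Sigma> \<eta>"
    unfolding closed_form_def
  proof (intro allI impI)
    fix i j k l assume quad: "quad \<Sigma> i j k l"
    note e = quad_edges[OF quad]
    obtain V where V: "subspace V" "dim V \<le> 4"
      and lifts: "lift x n i \<subseteq> V" "lift x n j \<subseteq> V" "lift x n k \<subseteq> V" "lift x n l \<subseteq> V"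
      using regular_quad_span[OF regular quad] by blast
    have "n i \<noteq> n j" using E[OF e(1)] by (auto simp: dd_def)
    then have q: "\<qq> \<notin> V"
      using lifts noncol quad unfolding noncollinear_quads_def
      by (intro infinity_not_in_span[OF V, of i j k l x n]) auto
    let ?\<omega> = "\<eta> i l + \<eta> l k + \<eta> k j + \<eta> j i"
    have in_Lambda2: "\<eta> b a \<in> Lambda2 V" if "lift x n a \<subseteq> V" "lift x n b \<subseteq> V" for a b
    proof -
      have "A b a *\<^sub>R Y a + B b a *\<^sub>R T a \<in> V" "T b - T a \<in> V"
        using that mem V(1) by (auto intro!: subspace_add subspace_scale subspace_diff)
      then show ?thesis unfolding Lambda2_def \<eta>_def by (blast intro: span_base)
    qed
    have "?\<omega> \<in> Lambda2 V"
      using in_Lambda2 lifts unfolding Lambda2_def by (intro span_add) auto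
    moreover have "contract ?\<omega> u v = 0" if u: "lie_form u \<qq> = 0" and v: "lie_form v \<qq> = 0" for u v
    proof -
      obtain b c e where u': "u = b *\<^sub>R \<qq> + c *\<^sub>R \<pp> + \<iota> e"
      proof -
        obtain a b c e where *: "u = a *\<^sub>R \<oo> + b *\<^sub>R \<qq> + c *\<^sub>R \<pp> + \<iota> e" using frame_spans by blast
        then show ?thesis using frame_coordinates(1)[OF *] u that by simp
      qed
      obtain b' c' e' where v': "v = b' *\<^sub>R \<qq> + c' *\<^sub>R \<pp> + \<iota> e'"
      proof -
        obtain a b c e where *: "v = a *\<^sub>R \<oo> + b *\<^sub>R \<qq> + c *\<^sub>R \<pp> + \<iota> e" using frame_spans by blast
        then show ?thesis using frame_coordinates(1)[OF *] v that by simp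
      qed
      \<comment> \<open>on each edge the contraction splits into a difference of \<open>F\<close> and two terms for the Leibniz rule\<close>
      define F where "F m = xc m \<bullet> (b' *\<^sub>R e - b *\<^sub>R e') + nc m \<bullet> (c' *\<^sub>R e - c *\<^sub>R e')" for m
      define G :: "real ^ 3 ^ 3 \<Rightarrow> real" where "G \<omega> = e \<bullet> (\<omega> *v e')" for \<omega>
      have G_add: "G (\<omega> + \<omega>') = G \<omega> + G \<omega>'" for \<omega> \<omega>'
        by (simp add: G_def matrix_vector_mult_add_rdistrib inner_right_distrib)
      have edge_value: "contract (\<eta> s r) u v
          = F s - F r + G (wedge (x r) (dd xc s r)) + G (wedge (n r) (dd nc s r))"
        if "edge \<Sigma> r s" for r s
      proof -
        have par: "dd xc s r = A s r *\<^sub>R dd n s r" "dd nc s r = B s r *\<^sub>R dd n s r"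
          using E[OF that] by auto
        have "F s - F r = dd xc s r \<bullet> (b' *\<^sub>R e - b *\<^sub>R e') + dd nc s r \<bullet> (c' *\<^sub>R e - c *\<^sub>R e')"
          by (simp add: F_def dd_def inner_diff_left)
        then show ?thesis
          unfolding G_def u' v' \<eta>_def Y_def T_def
          using contract_edge[OF par, of x b c e b' c' e'] by linarith
      qed
      have par: "wedge (dd x s r) (dd xc s r) = 0" "wedge (dd n s r) (dd nc s r) = 0"
        if "edge \<Sigma> r s" for r s
      proof -
        obtain \<rho> where "dd x s r = \<rho> *\<^sub>R dd n s r" "dd xc s r = A s r *\<^sub>R dd n s r"
          "dd nc s r = B s r *\<^sub>R dd n s r" using E[OF \<open>edge \<Sigma> r s\<close>] by blast
        then show "wedge (dd x s r) (dd xc s r) = 0" "wedge (dd n s r) (dd nc s r) = 0"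
          by (simp_all add: wedge_simps)
      qed
      have "contract ?\<omega> u v
        = G ((wedge (x i) (dd xc j i) + wedge (x j) (dd xc k j) + wedge (x k) (dd xc l k) + wedge (x l) (dd xc i l))
          + (wedge (n i) (dd nc j i) + wedge (n j) (dd nc k j) + wedge (n k) (dd nc l k) + wedge (n l) (dd nc i l)))"
        by (simp add: contract_simps edge_value e G_add)
      also have "\<dots> = G ((dd xc \<curlywedge> dd x) l k j i + (dd nc \<curlywedge> dd n) l k j i)"
        using e by (subst (1 2) curly_wedge_leibniz) (auto simp: par)
      also have "\<dots> = 0"
        using dual quad unfolding omega_dual_def by (simp add: G_def)
      finally show ?thesis .
    qed
    ultimately show "?\<omega> = 0" by (intro Lambda2_eq_0[OF V(1) _ q])
  qed
  moreover have "\<eta> i j \<in> Lambda2 (edge_sum (lift x n) i j) \<and>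
      (\<exists>s \<in> edge_meet (lift x n) i j. wedge3 (\<eta> i j) s \<noteq> 0)" if e: "edge \<Sigma> i j" for i j
  proof
    obtain \<rho> where E': "\<rho> * A i j + B i j \<noteq> 0" "dd n i j \<noteq> 0" "Y i - Y j = \<rho> *\<^sub>R (T i - T j)"
      using E[OF edge_sym[OF e]] by blast
    have "A i j *\<^sub>R Y j + B i j *\<^sub>R T j \<in> lift x n j"
      by (auto simp: lift_iff Y_def T_def)
    moreover have "0 \<in> lift x n i" "- T j \<in> lift x n j"
      using mem by (auto simp: lift_eq span_zero span_neg)
    ultimately have "0 + (A i j *\<^sub>R Y j + B i j *\<^sub>R T j) \<in> edge_sum (lift x n) i j"
      "T i + (- T j) \<in> edge_sum (lift x n) i j"
      unfolding edge_sum_def using mem by blast+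
    then show "\<eta> i j \<in> Lambda2 (edge_sum (lift x n) i j)"
      unfolding Lambda2_def \<eta>_def by (auto intro!: span_base)
    let ?s = "Y j - \<rho> *\<^sub>R T j"
    have sphere_mem: "Y m - \<rho> *\<^sub>R T m \<in> lift x n m" for m
      unfolding Y_def T_def lift_eq by (intro span_diff span_scale span_base) auto
    have "?s = Y i - \<rho> *\<^sub>R T i" using E'(3) by (simp add: algebra_simps)
    then have "?s \<in> edge_meet (lift x n) i j"
      unfolding edge_meet_def using sphere_mem[of i] sphere_mem[of j] by auto
    moreover have "wedge3 (\<eta> i j) ?s \<noteq> 0"
    proof
      assume "wedge3 (\<eta> i j) ?s = 0"
      moreover have "wedge3 (\<eta> i j) ?s = (\<rho> * A i j + B i j) *\<^sub>R wedge3 (wedge (Y j) (T j)) (T i - T j)"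
        by (simp add: \<eta>_def vec_eq_iff wedge3_def wedge_def algebra_simps)
      ultimately have "wedge3 (wedge (Y j) (T j)) (T i - T j) = 0" using E'(1) by simp
      \<comment> \<open>contraction of \<open>y \<and> t \<and> dt\<close> with \<open>q\<close>, \<open>p\<close> and \<open>dn\<close> isolates the square of \<open>dn\<close>\<close>
      from arg_cong[OF wedge3_eq_0_contract[OF this, of "\<iota> (dd n i j)"], of "\<lambda>\<omega>. contract \<omega> \<qq> \<pp>"]
      have "dd n i j \<bullet> dd n i j = 0"
        by (simp add: contract_simps contract_wedge Y_def T_def plane_lift_diff_product dd_def)
      then show False using E'(2) by simp
    qed
    ultimately show "\<exists>s \<in> edge_meet (lift x n) i j. wedge3 (\<eta> i j) s \<noteq> 0" by blast
  qed
  ultimately show ?thesis unfolding applicable_def by blast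
qed


text \<open>Only the gauge term \<open>d(r y \<and> t)\<close> separates a closed form of the general shape from one of the shape
  \<open>(A y + B t) \<and> dt\<close>; it changes \<open>A\<close> and \<open>B\<close> but not \<open>\<rho> A + B\<close>.\<close>

lemma omega_dual_of_applicable:
  assumes sc: "lattice_simply_connected \<Sigma>" and unit: "\<forall>i\<in>\<Sigma>. n i \<bullet> n i = 1"
    and radii: "\<And>i j. edge \<Sigma> i j \<Longrightarrow> n i \<noteq> n j \<and> (\<exists>\<rho>. dd x j i = \<rho> *\<^sub>R dd n j i)"
    and app: "applicable \<Sigma> (lift x n)"
  obtains xc nc where "omega_dual \<Sigma> n nc x xc"
proof -
  define Y T where "Y m = point_lift (x m)" and "T m = plane_lift (x m) (n m)" for m
  obtain \<eta> where one: "one_form \<Sigma> \<eta>" and closed: "closed_form \<Sigma> \<eta>"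
    and mem: "\<And>i j. edge \<Sigma> i j \<Longrightarrow> \<eta> i j \<in> Lambda2 (edge_sum (lift x n) i j)"
    and nondeg: "\<And>i j. edge \<Sigma> i j \<Longrightarrow> \<exists>s \<in> edge_meet (lift x n) i j. wedge3 (\<eta> i j) s \<noteq> 0"
    using app unfolding applicable_def by blast
  obtain r where r: "\<And>i j. edge \<Sigma> i j \<Longrightarrow> contract (\<eta> j i) \<qq> \<pp> = dd r j i"
    using closed_form_exact[OF sc one_form_linear[OF linear_contract one]
        closed_form_linear[OF linear_contract closed], of \<qq> \<pp>] by blast
  define \<eta>' where "\<eta>' j i = \<eta> j i - dd (\<lambda>m. r m *\<^sub>R wedge (Y m) (T m)) j i" for j i
  have one': "one_form \<Sigma> \<eta>'" and closed': "closed_form \<Sigma> \<eta>'"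
    unfolding \<eta>'_def using one_form_minus_dd[OF one] closed_form_minus_dd[OF closed] by blast+
  have E: "\<exists>\<rho> A B. dd x j i = \<rho> *\<^sub>R dd n j i \<and> dd n j i \<noteq> 0 \<and> \<rho> * A + B \<noteq> 0 \<and>
      \<eta>' j i = wedge (A *\<^sub>R Y i + B *\<^sub>R T i) (T j - T i)" if e: "edge \<Sigma> i j" for i j
  proof -
    have ij: "i \<in> \<Sigma>" "j \<in> \<Sigma>" using e by (auto simp: edge_def)
    obtain \<rho> where \<rho>: "dd x j i = \<rho> *\<^sub>R dd n j i" and n: "n i \<noteq> n j" using radii[OF e] by blast
    define D where "D = T j - T i"
    have Tj: "T j = T i + D" by (simp add: D_def)
    have "Y j - Y i = \<rho> *\<^sub>R D"
      unfolding Y_def D_def T_def using \<rho> unit ij by (intro point_lift_diff) (auto simp: dd_def)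
    then have Yj: "Y j = Y i + \<rho> *\<^sub>R D" by (simp add: algebra_simps)
    have D: "lie_form D \<qq> = 0" "lie_form D \<pp> = 0" "lie_form D (\<iota> w) = dd n j i \<bullet> w" for w
      by (simp_all add: D_def T_def plane_lift_diff_product dd_def)
    have "\<exists>\<alpha> \<beta> \<gamma>. w = \<alpha> *\<^sub>R Y i + \<beta> *\<^sub>R T i + \<gamma> *\<^sub>R D" if w: "w \<in> edge_sum (lift x n) j i" for w
    proof -
      obtain \<alpha> \<beta> \<gamma> \<delta> where "w = (\<alpha> *\<^sub>R Y j + \<beta> *\<^sub>R T j) + (\<gamma> *\<^sub>R Y i + \<delta> *\<^sub>R T i)"
        using w unfolding edge_sum_def lift_iff Y_def T_def by blast
      then have "w = (\<alpha> + \<gamma>) *\<^sub>R Y i + (\<beta> + \<delta>) *\<^sub>R T i + (\<rho> * \<alpha> + \<beta>) *\<^sub>R D"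
        by (simp add: Yj Tj algebra_simps)
      then show ?thesis by blast
    qed
    then obtain a A B where \<eta>: "\<eta> j i = a *\<^sub>R wedge (Y i) (T i) + wedge (A *\<^sub>R Y i + B *\<^sub>R T i) D"
      using Lambda2_three_vectors[OF mem[OF edge_sym[OF e]]] by blast
    have "contract (\<eta> j i) \<qq> \<pp> = a"
      by (simp add: \<eta> contract_simps contract_wedge lie_form_simps D) (simp add: Y_def T_def)
    then have a: "a = r j - r i" using r[OF e] by (simp add: dd_def)
    have "\<eta>' j i = wedge ((A - r j) *\<^sub>R Y i + (B + \<rho> * r j) *\<^sub>R T i) D"
      by (simp add: \<eta>'_def \<eta> a dd_def Yj Tj vec_eq_iff wedge_def algebra_simps)
    \<comment> \<open>if the coefficient vanished, the shared sphere \<open>y - \<rho> t\<close> would be a factor of \<open>\<eta>\<close>\<close>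
    moreover have "\<rho> * (A - r j) + (B + \<rho> * r j) \<noteq> 0"
    proof
      assume "\<rho> * (A - r j) + (B + \<rho> * r j) = 0"
      then have B: "B = - (\<rho> * A)" by (simp add: algebra_simps)
      have \<eta>_s: "\<eta> j i = wedge (Y i - \<rho> *\<^sub>R T i) (a *\<^sub>R T i + A *\<^sub>R D)"
        by (simp add: \<eta> B vec_eq_iff wedge_def algebra_simps)
      obtain s where s: "s \<in> lift x n j" "s \<in> lift x n i" and nz: "wedge3 (\<eta> j i) s \<noteq> 0"
        using nondeg[OF edge_sym[OF e]] unfolding edge_meet_def by blast
      obtain \<alpha> \<beta> where s1: "s = \<alpha> *\<^sub>R Y i + \<beta> *\<^sub>R T i" using s by (auto simp: lift_iff Y_def T_def)
      obtain \<gamma> \<delta> where s2: "s = \<gamma> *\<^sub>R Y j + \<delta> *\<^sub>R T j" using s by (auto simp: lift_iff Y_def T_def)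
      have "\<alpha> *\<^sub>R Y i + \<beta> *\<^sub>R T i = \<gamma> *\<^sub>R Y i + \<delta> *\<^sub>R T i + (\<rho> * \<gamma> + \<delta>) *\<^sub>R D"
        using s1 s2 by (simp add: Yj Tj algebra_simps)
      note eq = this
      have "\<alpha> = \<gamma>" "\<beta> = \<delta>"
        using lift_coefficients[OF eq[unfolded Y_def T_def]] D by (simp_all add: lie_form_simps)
      then have "(\<rho> * \<alpha> + \<beta>) *\<^sub>R D = 0" using eq by simp
      from arg_cong[OF this, of "\<lambda>v. lie_form v (\<iota> (dd n j i))"] have "\<rho> * \<alpha> + \<beta> = 0"
        using n by (simp add: lie_form_simps D dd_def)
      then have "\<beta> = - (\<rho> * \<alpha>)" by linarith
      then have "s = \<alpha> *\<^sub>R (Y i - \<rho> *\<^sub>R T i)" using s1 by (simp add: algebra_simps)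
      then have "wedge3 (\<eta> j i) s = 0" unfolding \<eta>_s by (simp only: wedge3_wedge_common)
      then show False using nz by blast
    qed
    ultimately show ?thesis using \<rho> n unfolding D_def by (auto simp: dd_def)
  qed
  \<comment> \<open>with \<open>u = q\<close> and \<open>u = p\<close>, the factors of \<open>o\<close> and of \<open>p\<close> in \<open>\<real>\<^sup>3\<close>\<close>
  define vec where "vec u \<omega> = (\<chi> c. - contract \<omega> u (\<iota> (axis c 1)))" for u and \<omega> :: "real ^ (4 + 2) ^ (4 + 2)"
  have lin: "linear (vec u)" for u
    by (auto intro!: linearI simp: vec_def vec_eq_iff contract_simps)
  obtain xc where xc: "\<And>i j. edge \<Sigma> i j \<Longrightarrow> vec \<qq> (\<eta>' j i) = dd xc j i"
    using closed_form_exact[OF sc one_form_linear[OF lin one'] closed_form_linear[OF lin closed']] by blast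
  obtain nc where nc: "\<And>i j. edge \<Sigma> i j \<Longrightarrow> vec \<pp> (\<eta>' j i) = dd nc j i"
    using closed_form_exact[OF sc one_form_linear[OF lin one'] closed_form_linear[OF lin closed']] by blast
  have F: "\<exists>\<rho> A B. dd x j i = \<rho> *\<^sub>R dd n j i \<and> dd n j i \<noteq> 0 \<and> \<rho> * A + B \<noteq> 0 \<and>
      dd xc j i = A *\<^sub>R dd n j i \<and> dd nc j i = B *\<^sub>R dd n j i \<and>
      (\<forall>a b. contract (\<eta>' j i) (\<iota> (axis a 1)) (\<iota> (axis b 1))
        = (wedge (x i) (dd xc j i) + wedge (n i) (dd nc j i)) $ a $ b)" if e: "edge \<Sigma> i j" for i j
  proof -
    obtain \<rho> A B where *: "dd x j i = \<rho> *\<^sub>R dd n j i" "dd n j i \<noteq> 0" "\<rho> * A + B \<noteq> 0"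
      and \<eta>: "\<eta>' j i = wedge (A *\<^sub>R Y i + B *\<^sub>R T i) (T j - T i)"
      using E[OF e] by blast
    have D: "lie_form (T j - T i) \<qq> = 0" "lie_form (T j - T i) \<pp> = 0"
      "lie_form (T j - T i) (\<iota> w) = dd n j i \<bullet> w" for w
      by (simp_all add: T_def plane_lift_diff_product dd_def)
    have P: "lie_form (A *\<^sub>R Y i + B *\<^sub>R T i) \<qq> = - A" "lie_form (A *\<^sub>R Y i + B *\<^sub>R T i) \<pp> = - B"
      "lie_form (A *\<^sub>R Y i + B *\<^sub>R T i) (\<iota> w) = A * (x i \<bullet> w) + B * (n i \<bullet> w)" for w
      by (simp_all add: Y_def T_def lie_form_simps)
    have xc': "dd xc j i = A *\<^sub>R dd n j i" and nc': "dd nc j i = B *\<^sub>R dd n j i"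
      unfolding xc[OF e, symmetric] nc[OF e, symmetric]
      by (simp_all add: vec_def \<eta> contract_wedge D P vec_eq_iff inner_axis)
    have "contract (\<eta>' j i) (\<iota> (axis a 1)) (\<iota> (axis b 1))
        = (wedge (x i) (dd xc j i) + wedge (n i) (dd nc j i)) $ a $ b" for a b
      unfolding \<eta> contract_wedge D P xc' nc' by (simp add: wedge_def inner_axis algebra_simps)
    then show ?thesis using * xc' nc' by blast
  qed
  have par: "wedge (dd x j i) (dd xc j i) = 0" "wedge (dd n j i) (dd nc j i) = 0"
    if e: "edge \<Sigma> i j" for i j
  proof -
    obtain \<rho> A B where "dd x j i = \<rho> *\<^sub>R dd n j i" "dd xc j i = A *\<^sub>R dd n j i"
      "dd nc j i = B *\<^sub>R dd n j i" using F[OF e] by blast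
    then show "wedge (dd x j i) (dd xc j i) = 0" "wedge (dd n j i) (dd nc j i) = 0"
      by (simp_all add: wedge_simps)
  qed
  have "(dd xc \<curlywedge> dd x) l k j i + (dd nc \<curlywedge> dd n) l k j i = 0" if quad: "quad \<Sigma> i j k l" for i j k l
  proof -
    note e = quad_edges[OF quad]
    have M: "contract (\<eta>' s r) (\<iota> (axis a 1)) (\<iota> (axis b 1))
        = (wedge (x r) (dd xc s r) + wedge (n r) (dd nc s r)) $ a $ b" if "edge \<Sigma> r s" for a b r s
      using F[OF that] by blast
    have "((dd xc \<curlywedge> dd x) l k j i + (dd nc \<curlywedge> dd n) l k j i) $ a $ b
        = contract (\<eta>' i l + \<eta>' l k + \<eta>' k j + \<eta>' j i) (\<iota> (axis a 1)) (\<iota> (axis b 1))" for a b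
      using e by (subst (1 2) curly_wedge_leibniz[symmetric]) (simp_all add: par contract_simps M)
    moreover have "\<eta>' i l + \<eta>' l k + \<eta>' k j + \<eta>' j i = 0"
      using closed' quad unfolding closed_form_def by blast
    ultimately show ?thesis by (simp add: vec_eq_iff contract_simps)
  qed
  moreover have "n i \<noteq> n j \<and> (\<exists>\<rho> A B. dd x j i = \<rho> *\<^sub>R dd n j i \<and> dd xc j i = A *\<^sub>R dd n j i \<and>
      dd nc j i = B *\<^sub>R dd n j i \<and> \<rho> * A + B \<noteq> 0)" if "edge \<Sigma> i j" for i j
    using F[OF that] radii[OF that] by blast
  ultimately have "omega_dual \<Sigma> n nc x xc" unfolding omega_dual_def by blast
  then show ?thesis using that by blast
qed

end


section \<open>Principal nets and associated nets\<close>

lemma collinear_quad_transfer: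
  assumes par: "\<And>r s. edge \<Sigma> r s \<Longrightarrow> \<exists>\<rho>. dd x s r = \<rho> *\<^sub>R dd n s r"
    and quad: "quad \<Sigma> i j k l" and col: "collinear {n i, n j, n k, n l}"
  shows "collinear {x i, x j, x k, x l}"
proof -
  obtain u where u: "\<And>v w. v \<in> {n i, n j, n k, n l} \<Longrightarrow> w \<in> {n i, n j, n k, n l} \<Longrightarrow> \<exists>c. v - w = c *\<^sub>R u"
    using col unfolding collinear_def by blast
  have step: "\<exists>c. x s - x r = c *\<^sub>R u" if e: "edge \<Sigma> r s" and rs: "r \<in> {i, j, k, l}" "s \<in> {i, j, k, l}" for r s
  proof -
    obtain \<rho> where "dd x s r = \<rho> *\<^sub>R dd n s r" using par[OF e] by blast
    moreover obtain c where "n s - n r = c *\<^sub>R u" using u[of "n s" "n r"] rs by blast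
    ultimately have "x s - x r = (\<rho> * c) *\<^sub>R u" by (simp add: dd_def)
    then show ?thesis by blast
  qed
  note e = quad_edges[OF quad]
  obtain b where b: "x j - x i = b *\<^sub>R u" using step[OF e(1)] by auto
  obtain c where c: "x k - x j = c *\<^sub>R u" using step[OF e(2)] by auto
  obtain d where d: "x i - x l = d *\<^sub>R u" using step[OF e(4)] by auto
  have base: "\<exists>t. v = x i + t *\<^sub>R u" if "v \<in> {x i, x j, x k, x l}" for v
  proof -
    have "x i = x i + 0 *\<^sub>R u" by simp
    moreover have "x j = x i + b *\<^sub>R u" using b by (simp add: algebra_simps)
    moreover have "x k = x i + (b + c) *\<^sub>R u"
      using b c by (simp add: scaleR_add_left b[symmetric] c[symmetric])
    moreover have "x l = x i + (- d) *\<^sub>R u" using d by (simp add: d[symmetric])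
    ultimately show ?thesis using that by blast
  qed
  show ?thesis
    unfolding collinear_def
  proof (rule exI[of _ u], intro ballI)
    fix v w assume "v \<in> {x i, x j, x k, x l}" "w \<in> {x i, x j, x k, x l}"
    then obtain s t where "v = x i + s *\<^sub>R u" "w = x i + t *\<^sub>R u" using base by meson
    then have "v - w = (s - t) *\<^sub>R u" by (simp add: scaleR_left_diff_distrib)
    then show "\<exists>c. v - w = c *\<^sub>R u" by blast
  qed
qed

text \<open>Since \<open>dn = - \<kappa> dx\<close>, multiples \<open>A\<close>, \<open>B\<close> of \<open>dx\<close> are multiples \<open>- A/\<kappa>\<close>, \<open>- B/\<kappa>\<close> of \<open>dn\<close>, and with
  \<open>\<rho> = - 1/\<kappa>\<close> the nondegeneracy coefficient is \<open>(A - \<kappa> B)/\<kappa>\<^sup>2\<close>.\<close>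

lemma associated_nets_iff_omega_dual:
  assumes curv: "principal_curvatures \<Sigma> x n \<kappa>" and immersed: "\<And>i j. edge \<Sigma> i j \<Longrightarrow> x i \<noteq> x j"
  shows "associated_nets \<Sigma> x n \<kappa> xc nc \<longleftrightarrow> omega_dual \<Sigma> n nc x xc"
proof -
  have edge_iff: "((\<exists>c. dd xc j i = c *\<^sub>R dd x j i) \<and> (\<exists>c. dd nc j i = c *\<^sub>R dd x j i) \<and>
        dd xc j i \<noteq> \<kappa> i j *\<^sub>R dd nc j i) \<longleftrightarrow>
      (n i \<noteq> n j \<and> (\<exists>\<rho> A B. dd x j i = \<rho> *\<^sub>R dd n j i \<and> dd xc j i = A *\<^sub>R dd n j i \<and>
           dd nc j i = B *\<^sub>R dd n j i \<and> \<rho> * A + B \<noteq> 0))" (is "?L \<longleftrightarrow> ?R") if e: "edge \<Sigma> i j" for i j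
  proof -
    define v where "v = dd x j i"
    have k: "\<kappa> i j \<noteq> 0" and eq: "\<kappa> i j *\<^sub>R x i + n i = \<kappa> i j *\<^sub>R x j + n j"
      using curv e unfolding principal_curvatures_def by blast+
    have v: "v \<noteq> 0" using immersed[OF e] by (simp add: v_def dd_def)
    have n: "dd n j i = (- \<kappa> i j) *\<^sub>R v"
      using eq by (simp add: v_def dd_def algebra_simps)
    have nij: "n i \<noteq> n j" using n v k by (auto simp: dd_def)
    show ?thesis
    proof
      assume ?L
      then obtain A B where AB: "dd xc j i = A *\<^sub>R v" "dd nc j i = B *\<^sub>R v" "dd xc j i \<noteq> \<kappa> i j *\<^sub>R dd nc j i"
        unfolding v_def by blast
      then have "A - \<kappa> i j * B \<noteq> 0" by auto
      moreover have "(- (1 / \<kappa> i j)) * (- (A / \<kappa> i j)) + - (B / \<kappa> i j) = (A - \<kappa> i j * B) / (\<kappa> i j * \<kappa> i j)"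
        using k by (simp add: field_simps)
      ultimately have "(- (1 / \<kappa> i j)) * (- (A / \<kappa> i j)) + - (B / \<kappa> i j) \<noteq> 0" using k by simp
      moreover have "v = (- (1 / \<kappa> i j)) *\<^sub>R dd n j i" "dd xc j i = (- (A / \<kappa> i j)) *\<^sub>R dd n j i"
        "dd nc j i = (- (B / \<kappa> i j)) *\<^sub>R dd n j i"
        using k AB by (simp_all add: n)
      ultimately show ?R using nij unfolding v_def by blast
    next
      assume ?R
      then obtain \<rho> A B where AB: "v = \<rho> *\<^sub>R dd n j i" "dd xc j i = A *\<^sub>R dd n j i"
          "dd nc j i = B *\<^sub>R dd n j i" "\<rho> * A + B \<noteq> 0" unfolding v_def by blast
      have "1 *\<^sub>R v = (- \<rho> * \<kappa> i j) *\<^sub>R v" using AB(1) n by simp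
      then have "1 = - \<rho> * \<kappa> i j" using v by (simp only: scaleR_cancel_right) simp
      then have \<rho>: "\<rho> * \<kappa> i j = -1" by simp
      have par: "dd xc j i = (- A * \<kappa> i j) *\<^sub>R v" "dd nc j i = (- B * \<kappa> i j) *\<^sub>R v"
        using AB n by simp_all
      have "dd xc j i \<noteq> \<kappa> i j *\<^sub>R dd nc j i"
      proof
        assume "dd xc j i = \<kappa> i j *\<^sub>R dd nc j i"
        then have "A * \<kappa> i j = \<kappa> i j * B * \<kappa> i j" using v by (simp add: par mult.commute)
        then have "A = \<kappa> i j * B" using k by simp
        then have "\<rho> * A + B = (\<rho> * \<kappa> i j + 1) * B" by (simp add: algebra_simps)
        then show False using AB(4) \<rho> by simp
      qed
      then show ?L using par unfolding v_def by blast
    qed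
  qed
  show ?thesis
    unfolding associated_nets_def omega_dual_def edge_parallel_def using edge_iff by blast
qed

lemma associated_principal_inf:
  assumes unit: "\<forall>i\<in>\<Sigma>. n i \<in> sphere 0 1" and curv: "principal_curvatures \<Sigma> x n \<kappa>"
    and par: "edge_parallel \<Sigma> xc x"
  shows "principal_net_inf \<Sigma> xc n" and "(\<And>i j. edge \<Sigma> i j \<Longrightarrow> xc i \<noteq> xc j) \<Longrightarrow> principal_net \<Sigma> xc n"
proof -
  \<comment> \<open>the quotient of \<open>\<kappa>\<close> by the ratio of \<open>dxc\<close> to \<open>dx\<close>, in a form visibly symmetric in the end-points\<close>
  define \<mu> where "\<mu> i j = \<kappa> i j / ((dd xc j i \<bullet> dd x j i) / (dd x j i \<bullet> dd x j i))" for i j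
  have \<mu>: "\<mu> i j = \<mu> j i \<and> \<mu> i j \<noteq> 0 \<and> \<mu> i j *\<^sub>R xc i + n i = \<mu> i j *\<^sub>R xc j + n j"
    if e: "edge \<Sigma> i j" and ne: "xc i \<noteq> xc j" for i j
  proof -
    have \<kappa>: "\<kappa> i j = \<kappa> j i" "\<kappa> i j \<noteq> 0" "\<kappa> i j *\<^sub>R x i + n i = \<kappa> i j *\<^sub>R x j + n j"
      using curv e unfolding principal_curvatures_def by blast+
    obtain c where c: "dd xc j i = c *\<^sub>R dd x j i" using par e unfolding edge_parallel_def by blast
    have nz: "c \<noteq> 0" "dd x j i \<noteq> 0" using c ne by (auto simp: dd_def)
    then have \<mu>_eq: "\<mu> i j = \<kappa> i j / c" by (simp add: \<mu>_def c)
    have odd: "dd u i j = - dd u j i" for u :: "'a lattice \<Rightarrow> real ^ 3" by (simp add: dd_def)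
    have "\<mu> j i = \<mu> i j" unfolding \<mu>_def odd \<kappa>(1) by simp
    moreover have "\<mu> i j *\<^sub>R dd xc j i = \<kappa> i j *\<^sub>R dd x j i" using nz by (simp add: \<mu>_eq c)
    moreover have "\<kappa> i j *\<^sub>R dd x j i = n i - n j" using \<kappa>(3) by (simp add: dd_def algebra_simps)
    ultimately have "\<mu> j i = \<mu> i j" "\<mu> i j *\<^sub>R dd xc j i = n i - n j" by simp_all
    moreover from this(2) have "\<mu> i j *\<^sub>R xc i + n i = \<mu> i j *\<^sub>R xc j + n j"
      by (simp add: dd_def algebra_simps)
    ultimately show ?thesis using \<kappa> nz by (simp add: \<mu>_eq)
  qed
  show "principal_net_inf \<Sigma> xc n" unfolding principal_net_inf_def using unit \<mu> by blast
  show "principal_net \<Sigma> xc n" if "\<And>i j. edge \<Sigma> i j \<Longrightarrow> xc i \<noteq> xc j"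
    unfolding principal_net_def principal_curvatures_def using unit \<mu> that by blast
qed

theorem theorem6p5:
  fixes \<Sigma> :: "('N::finite) lattice set"
    and x n :: "'N lattice \<Rightarrow> real ^ 3"
    and \<kappa> :: "'N lattice \<Rightarrow> 'N lattice \<Rightarrow> real"
    and \<oo> \<qq> \<pp> :: R42 and \<iota> :: "real ^ 3 \<Rightarrow> R42"
  assumes frame: "lie_frame \<oo> \<qq> \<pp> \<iota>"
    and simply_connected: "lattice_simply_connected \<Sigma>"
    and unit_normal: "\<forall>i\<in>\<Sigma>. n i \<in> sphere 0 1"
    and curvatures: "principal_curvatures \<Sigma> x n \<kappa>"
    and regular: "regular_map \<Sigma> (legendre_lift \<oo> \<qq> \<pp> \<iota> x n)"
  shows "(omega_net \<Sigma> (legendre_lift \<oo> \<qq> \<pp> \<iota> x n) \<longrightarrow> (\<exists>xc nc. associated_nets \<Sigma> x n \<kappa> xc nc)) \<and>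
    (noncollinear_quads \<Sigma> x \<longrightarrow>
      (omega_net \<Sigma> (legendre_lift \<oo> \<qq> \<pp> \<iota> x n) \<longleftrightarrow> (\<exists>xc nc. associated_nets \<Sigma> x n \<kappa> xc nc))) \<and>
    (\<forall>xc nc. associated_nets \<Sigma> x n \<kappa> xc nc \<longrightarrow>
       principal_net_inf \<Sigma> xc n \<and>
       ((\<forall>i j. edge \<Sigma> i j \<longrightarrow> xc i \<noteq> xc j) \<longrightarrow> principal_net \<Sigma> xc n) \<and>
       (noncollinear_quads \<Sigma> x \<and> regular_map \<Sigma> (legendre_lift \<oo> \<qq> \<pp> \<iota> xc n) \<longrightarrow>
          omega_net \<Sigma> (legendre_lift \<oo> \<qq> \<pp> \<iota> xc n))) \<and>
    (\<forall>xc nc. edge_parallel \<Sigma> xc x \<and> edge_parallel \<Sigma> nc x \<longrightarrow>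
      ((\<forall>i j k l. quad \<Sigma> i j k l \<longrightarrow> (dd xc \<curlywedge> dd x) l k j i + (dd nc \<curlywedge> dd n) l k j i = 0) \<longleftrightarrow>
       (\<forall>i j k l. quad \<Sigma> i j k l \<longrightarrow> mixed_area xc x l k j i + mixed_area nc n l k j i = 0)))"
proof -
  interpret lie_sphere_frame \<oo> \<qq> \<pp> \<iota> by standard (rule frame)
  have unit: "\<forall>i\<in>\<Sigma>. n i \<bullet> n i = 1"
    using unit_normal by (simp add: norm_eq_1)
  have \<kappa>: "\<kappa> i j \<noteq> 0" "dd n j i = (- \<kappa> i j) *\<^sub>R dd x j i" if "edge \<Sigma> i j" for i j
  proof -
    have "\<kappa> i j \<noteq> 0 \<and> \<kappa> i j *\<^sub>R x i + n i = \<kappa> i j *\<^sub>R x j + n j"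
      using curvatures that unfolding principal_curvatures_def by blast
    then show "\<kappa> i j \<noteq> 0" "dd n j i = (- \<kappa> i j) *\<^sub>R dd x j i"
      by (simp_all add: dd_def algebra_simps)
  qed
  have radius: "dd x j i = (- (1 / \<kappa> i j)) *\<^sub>R dd n j i" if "edge \<Sigma> i j" for i j
    using \<kappa>[OF that] by simp
  have immersed: "x i \<noteq> x j" if e: "edge \<Sigma> i j" for i j
  proof
    assume "x i = x j"
    moreover from this have "n i = n j" using \<kappa>(2)[OF e] by (simp add: dd_def)
    ultimately have "lift x n i = lift x n j" by (simp add: lift_eq)
    moreover have "subspace (lift x n j)" by (simp add: lift_eq)
    ultimately have "edge_sum (lift x n) i j \<subseteq> lift x n j"
      unfolding edge_sum_def by (auto intro: subspace_add)
    then have "dim (edge_sum (lift x n) i j) \<le> 2" using dim_subset lift_dim by metis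
    then show False using regular e unfolding regular_map_def by fastforce
  qed
  have assoc: "associated_nets \<Sigma> x n \<kappa> xc nc \<longleftrightarrow> omega_dual \<Sigma> n nc x xc" for xc nc
    by (rule associated_nets_iff_omega_dual[OF curvatures immersed])
  have noncol: "noncollinear_quads \<Sigma> n" if "noncollinear_quads \<Sigma> x"
    unfolding noncollinear_quads_def
  proof (intro allI impI notI)
    fix i j k l assume quad: "quad \<Sigma> i j k l" and col: "collinear {n i, n j, n k, n l}"
    have "collinear {x i, x j, x k, x l}"
      by (rule collinear_quad_transfer[OF _ quad col]) (use radius in blast)
    then show False using \<open>noncollinear_quads \<Sigma> x\<close> quad unfolding noncollinear_quads_def by blast
  qed
  have only_if: "\<exists>xc nc. associated_nets \<Sigma> x n \<kappa> xc nc" if "omega_net \<Sigma> (lift x n)"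
  proof -
    have app: "applicable \<Sigma> (lift x n)" using that unfolding omega_net_def by blast
    have "n i \<noteq> n j \<and> (\<exists>\<rho>. dd x j i = \<rho> *\<^sub>R dd n j i)" if e: "edge \<Sigma> i j" for i j
    proof
      show "n i \<noteq> n j" using radius[OF e] immersed[OF e] by (auto simp: dd_def)
      show "\<exists>\<rho>. dd x j i = \<rho> *\<^sub>R dd n j i" using radius[OF e] by blast
    qed
    then obtain xc nc where "omega_dual \<Sigma> n nc x xc"
      using omega_dual_of_applicable[OF simply_connected unit _ app] by blast
    then show ?thesis using assoc by blast
  qed
  have omega: "omega_net \<Sigma> (lift u n)"
    if "omega_dual \<Sigma> n nc u uc" "noncollinear_quads \<Sigma> x" "regular_map \<Sigma> (lift u n)" for u uc nc
    unfolding omega_net_def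
    using legendre_map_lift[OF that(1) unit] applicable_lift[OF that(1) unit that(3) noncol[OF that(2)]]
      that(3) by blast
  have "principal_net_inf \<Sigma> xc n \<and>
      ((\<forall>i j. edge \<Sigma> i j \<longrightarrow> xc i \<noteq> xc j) \<longrightarrow> principal_net \<Sigma> xc n) \<and>
      (noncollinear_quads \<Sigma> x \<and> regular_map \<Sigma> (lift xc n) \<longrightarrow> omega_net \<Sigma> (lift xc n))"
    if a: "associated_nets \<Sigma> x n \<kappa> xc nc" for xc nc
  proof -
    have "edge_parallel \<Sigma> xc x" using a unfolding associated_nets_def by blast
    note associated_principal_inf[OF unit_normal curvatures this]
    moreover have "omega_dual \<Sigma> n nc xc x" using a assoc omega_dual_sym by blast
    ultimately show ?thesis using omega by blast
  qed
  moreover have "omega_net \<Sigma> (lift x n) \<longleftrightarrow> (\<exists>xc nc. associated_nets \<Sigma> x n \<kappa> xc nc)"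
    if "noncollinear_quads \<Sigma> x"
    using only_if omega assoc that regular by blast
  moreover have "(\<forall>i j k l. quad \<Sigma> i j k l \<longrightarrow> (dd xc \<curlywedge> dd x) l k j i + (dd nc \<curlywedge> dd n) l k j i = 0) \<longleftrightarrow>
      (\<forall>i j k l. quad \<Sigma> i j k l \<longrightarrow> mixed_area xc x l k j i + mixed_area nc n l k j i = 0)" for xc nc
    by (simp add: mixed_area_def flip: scaleR_add_right)
  ultimately show ?thesis using only_if by blast
qed

end
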